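(* Let $\mathcal H$ be a separable complex Hilbert space, $H_0\ge 0$ a self-adjoint operator in $\mathcal H$, and $\mathcal H_{+1}(H_0)\subset\mathcal H\subset\mathcal H_{-1}(H_0)$ the associated scale of spaces. Let $V:\mathcal H_{+1}(H_0)\to\mathcal H_{-1}(H_0)$ be a bounded linear operator, and put $$A_V(z):=-(H_0-zI_{\mathcal H})^{-1/2}\,V\,(H_0-zI_{\mathcal H})^{-1/2},\quad z\in\rho(H_0).$$ Assume that $A_V(z)$ is a compact operator on $\mathcal H$ for some (hence, all) $z\in\rho(H_0)$ and that $\|A_V(E_0)\|_{\mathcal B(\mathcal H)}<1$ for some $E_0\in(-\infty,0)$. Let $\mathcal D_{H_0,V}:=\{z\in\rho(H_0)\,|\,1\notin\rho(A_V(z))\}$ and $$R(z):=(H_0-zI_{\mathcal H})^{-1/2}[I_{\mathcal H}-A_V(z)]^{-1}(H_0-zI_{\mathcal H})^{-1/2},\quad z\in\rho(H_0)\setminus\mathcal D_{H_0,V}.$$ Then $R(\cdot)$ uniquely defines a densely defined, closed, linear operator $H$ in $\mathcal H$ (the same $H$ for all $z$) by $$R(z)=(H-zI_{\mathcal H})^{-1},\quad z\in\rho(H_0)\setminus\mathcal D_{H_0,V}.$$ Furthermore, $\rho(H_0)\setminus\mathcal D_{H_0,V}\subseteq\rho(H)$, and $$(H-zI_{\mathcal H})^{-1}-(H_0-zI_{\mathcal H})^{-1}\ \text{ is compact on }\mathcal H\text{ for all } z\in\rho(H_0)\cap\rho(H).$$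
   Context: Inner products are linear in the second argument; $\rho(\cdot)$ denotes the resolvent set. The complex square root is fixed by $z^{1/2}=|z|^{1/2}e^{i\arg(z)/2}$, $\arg(z)\in[0,2\pi)$, $0^{1/2}=0$. With $E_{H_0}$ the spectral family of $H_0$, $(H_0-zI_{\mathcal H})^{1/2}=\int_{\sigma(H_0)}(\lambda-z)^{1/2}\,dE_{H_0}(\lambda)$ for $z\in\mathbb C$ and $(H_0-zI_{\mathcal H})^{-1/2}=\int_{\sigma(H_0)}(\lambda-z)^{-1/2}\,dE_{H_0}(\lambda)$ for $z\in\rho(H_0)$. $\mathcal H_{+1}(H_0)=\operatorname{dom}(H_0^{1/2})$ is a Hilbert space with inner product $(f,g)_{\mathcal H_{+1}(H_0)}=(H_0^{1/2}f,H_0^{1/2}g)_{\mathcal H}+(f,g)_{\mathcal H}$. $\mathcal H_{-1}(H_0)=[\mathcal H_{+1}(H_0)]^*$ is the conjugate dual, i.e., the space of bounded conjugate linear functionals on $\mathcal H_{+1}(H_0)$, with pairing $\langle g,\Psi\rangle=\Psi(g)$ for $g\in\mathcal H_{+1}(H_0)$, $\Psi\in\mathcal H_{-1}(H_0)$. $\mathcal H$ is regarded as a subspace of $\mathcal H_{-1}(H_0)$ by identifying $f\in\mathcal H$ with $\Psi_f$, $\Psi_f(g)=(g,f)_{\mathcal H}$. For $z\in\rho(H_0)$, $(H_0-zI_{\mathcal H})^{-1/2}$ maps $\mathcal H$ boundedly into $\mathcal H_{+1}(H_0)$. It also extends to a bounded operator $\mathcal H_{-1}(H_0)\to\mathcal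 H$, denoted by the same symbol: for $\Psi\in\mathcal H_{-1}(H_0)$, $(H_0-zI_{\mathcal H})^{-1/2}\Psi$ is the unique $f_\Psi\in\mathcal H$ with $(g,f_\Psi)_{\mathcal H}=\langle [(H_0-zI_{\mathcal H})^{-1/2}]^*g,\Psi\rangle$ for all $g\in\mathcal H$. In $A_V(z)$ the right factor is the map $\mathcal H\to\mathcal H_{+1}(H_0)$ and the left factor is this extension $\mathcal H_{-1}(H_0)\to\mathcal H$, so $A_V(z)\in\mathcal B(\mathcal H)$. *)

theory Defs
  imports "HOL-Analysis.Analysis"
begin

section \<open>Complex Hilbert spaces\<close>

text \<open>
  The norm, the metric and the real inner product are those of \<^class>\<open>real_inner\<close>; the axiom
  \<open>Re_cinner\<close> makes the real inner product the real part of the complex one, so that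
  \<open>norm x = sqrt (Re (cinner x x))\<close>.  \<open>cinner\<close> is linear in its second argument.
\<close>

class chilbert_space = real_inner + banach +
  fixes scaleC :: "complex \<Rightarrow> 'a \<Rightarrow> 'a" (infixr \<open>*\<^sub>C\<close> 75)
    and cinner :: "'a \<Rightarrow> 'a \<Rightarrow> complex"
  assumes scaleC_add_right: "c *\<^sub>C (x + y) = c *\<^sub>C x + c *\<^sub>C y"
    and scaleC_add_left: "(c + d) *\<^sub>C x = c *\<^sub>C x + d *\<^sub>C x"
    and scaleC_scaleC: "c *\<^sub>C (d *\<^sub>C x) = (c * d) *\<^sub>C x"
    and scaleC_of_real: "complex_of_real r *\<^sub>C x = r *\<^sub>R x"
    and cinner_commute: "cinner x y = cnj (cinner y x)"
    and cinner_add_right: "cinner x (y + z) = cinner x y + cinner x z"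
    and cinner_scaleC_right: "cinner x (c *\<^sub>C y) = c * cinner x y"
    and Re_cinner: "Re (cinner x y) = inner x y"

definition bounded_clinear :: "('a::chilbert_space \<Rightarrow> 'a) \<Rightarrow> bool" where
  "bounded_clinear B \<longleftrightarrow> bounded_linear B \<and> (\<forall>c x. B (c *\<^sub>C x) = c *\<^sub>C B x)"

definition compact_op :: "('a::chilbert_space \<Rightarrow> 'a) \<Rightarrow> bool" where
  "compact_op B \<longleftrightarrow> bounded_clinear B \<and> (\<forall>S. bounded S \<longrightarrow> compact (closure (B ` S)))"


section \<open>Operators with a domain\<close>

text \<open>
  An operator in a Hilbert space is a partial map; its domain is \<^const>\<open>dom\<close>.  Two operators are
  equal iff they have the same domain and the same values on it.
\<close>

type_synonym 'a oper = "'a \<Rightarrow> 'a option"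

definition app :: "'a oper \<Rightarrow> 'a \<Rightarrow> 'a" where
  "app T f = the (T f)"

definition linear_op :: "'a::chilbert_space oper \<Rightarrow> bool" where
  "linear_op T \<longleftrightarrow> 0 \<in> dom T \<and>
     (\<forall>f\<in>dom T. \<forall>g\<in>dom T. T (f + g) = Some (app T f + app T g)) \<and>
     (\<forall>c. \<forall>f\<in>dom T. T (c *\<^sub>C f) = Some (c *\<^sub>C app T f))"

definition densely_defined :: "'a::chilbert_space oper \<Rightarrow> bool" where
  "densely_defined T \<longleftrightarrow> closure (dom T) = UNIV"

definition closed_op :: "'a::chilbert_space oper \<Rightarrow> bool" where
  "closed_op T \<longleftrightarrow> closed {(f, h). T f = Some h}"

text \<open>Meaningful for densely defined \<open>T\<close>, where the vector \<open>h\<close> below is unique.\<close>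

definition adjoint_op :: "'a::chilbert_space oper \<Rightarrow> 'a oper" where
  "adjoint_op T = (\<lambda>g. if \<exists>h. \<forall>f\<in>dom T. cinner g (app T f) = cinner h f
                       then Some (THE h. \<forall>f\<in>dom T. cinner g (app T f) = cinner h f)
                       else None)"

definition selfadjoint_op :: "'a::chilbert_space oper \<Rightarrow> bool" where
  "selfadjoint_op T \<longleftrightarrow> linear_op T \<and> densely_defined T \<and> adjoint_op T = T"

definition nonneg_op :: "'a::chilbert_space oper \<Rightarrow> bool" where
  "nonneg_op T \<longleftrightarrow> (\<forall>f\<in>dom T. cinner f (app T f) \<in> \<real>\<^sub>\<ge>\<^sub>0)"

definition shift_op :: "'a::chilbert_space oper \<Rightarrow> complex \<Rightarrow> 'a oper" where
  "shift_op T z = (\<lambda>f. map_option (\<lambda>h. h - z *\<^sub>C f) (T f))"  \<comment> \<open>\<open>T - z I\<close>\<close>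

definition injective_op :: "'a oper \<Rightarrow> bool" where
  "injective_op T \<longleftrightarrow> inj_on T (dom T)"

text \<open>The inverse of an injective operator, with domain the range of \<open>T\<close>.\<close>

definition inverse_op :: "'a oper \<Rightarrow> 'a oper" where
  "inverse_op T = (\<lambda>h. if h \<in> ran T then Some (THE f. T f = Some h) else None)"

text \<open>The statement \<open>B = (T - z I)\<^sup>-\<^sup>1\<close> for an everywhere defined \<open>B\<close>.\<close>

definition is_resolvent_at :: "'a::chilbert_space oper \<Rightarrow> complex \<Rightarrow> ('a \<Rightarrow> 'a) \<Rightarrow> bool" where
  "is_resolvent_at T z B \<longleftrightarrow>
     injective_op (shift_op T z) \<and> inverse_op (shift_op T z) = (\<lambda>h. Some (B h))"

definition resolvent :: "'a::chilbert_space oper \<Rightarrow> complex \<Rightarrow> 'a \<Rightarrow> 'a" where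
  "resolvent T z = app (inverse_op (shift_op T z))"

definition resolvent_set :: "'a::chilbert_space oper \<Rightarrow> complex set" where
  "resolvent_set T = {z. injective_op (shift_op T z) \<and> ran (shift_op T z) = UNIV \<and>
                         bounded_clinear (resolvent T z)}"

definition spectrum :: "'a::chilbert_space oper \<Rightarrow> complex set" where
  "spectrum T = - resolvent_set T"


section \<open>Spectral measures and spectral integrals\<close>

text \<open>
  The spectral family is taken as a projection-valued measure on the Borel sets of the real line;
  the resolution of the identity is \<open>E {..t}\<close>.  Only the values of \<open>E\<close> on Borel sets matter.
\<close>

definition projection_valued_measure :: "(real set \<Rightarrow> 'a::chilbert_space \<Rightarrow> 'a) \<Rightarrow> bool" where
  "projection_valued_measure E \<longleftrightarrow>
     (\<forall>B\<in>sets borel. bounded_clinear (E B) \<and> E B \<circ> E B = E B \<and>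
                     (\<forall>f g. cinner g (E B f) = cinner (E B g) f)) \<and>
     E UNIV = id \<and>
     (\<forall>A f. range A \<subseteq> sets borel \<longrightarrow> disjoint_family A \<longrightarrow>
            (\<lambda>n::nat. E (A n) f) sums E (\<Union>n. A n) f)"

definition spectral_measure_at ::
    "(real set \<Rightarrow> 'a::chilbert_space \<Rightarrow> 'a) \<Rightarrow> 'a \<Rightarrow> real measure" where
  "spectral_measure_at E f = measure_of UNIV (sets borel) (\<lambda>B. ennreal ((norm (E B f))\<^sup>2))"

definition simple_spectral_integral ::
    "(real set \<Rightarrow> 'a::chilbert_space \<Rightarrow> 'a) \<Rightarrow> (real \<Rightarrow> complex) \<Rightarrow> 'a \<Rightarrow> 'a" where
  "simple_spectral_integral E s f = (\<Sum>c\<in>range s. c *\<^sub>C E (s -` {c}) f)"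

text \<open>
  The domain of \<open>\<integral> \<phi> dE\<close> consists of all \<open>f\<close> with \<open>\<phi>\<close> square integrable with respect to
  \<open>\<parallel>E(\<cdot>) f\<parallel>\<^sup>2\<close>; the value at \<open>f\<close> is the limit of integrals of simple functions that approximate
  \<open>\<phi>\<close> in that \<open>L\<^sup>2\<close> space.
\<close>

definition spectral_integral ::
    "(real set \<Rightarrow> 'a::chilbert_space \<Rightarrow> 'a) \<Rightarrow> (real \<Rightarrow> complex) \<Rightarrow> 'a oper" where
  "spectral_integral E \<phi> = (\<lambda>f.
     if (\<integral>\<^sup>+ t. ennreal ((cmod (\<phi> t))\<^sup>2) \<partial>spectral_measure_at E f) < \<infinity>
     then Some (THE h. \<exists>s. (\<forall>n::nat. simple_function borel (s n)) \<and>
            (\<lambda>n. \<integral>\<^sup>+ t. ennreal ((cmod (s n t - \<phi> t))\<^sup>2) \<partial>spectral_measure_at E f)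
              \<longlonglongrightarrow> 0 \<and>
            (\<lambda>n. simple_spectral_integral E (s n) f) \<longlonglongrightarrow> h)
     else None)"

definition spectral_integral_on ::
    "(real set \<Rightarrow> 'a::chilbert_space \<Rightarrow> 'a) \<Rightarrow> real set \<Rightarrow> (real \<Rightarrow> complex) \<Rightarrow> 'a oper" where
  "spectral_integral_on E S \<phi> = spectral_integral E (\<lambda>t. if t \<in> S then \<phi> t else 0)"

definition is_spectral_family ::
    "(real set \<Rightarrow> 'a::chilbert_space \<Rightarrow> 'a) \<Rightarrow> 'a oper \<Rightarrow> bool" where
  "is_spectral_family E T \<longleftrightarrow>
     projection_valued_measure E \<and> T = spectral_integral E (\<lambda>t. complex_of_real t)"


section \<open>Square roots of \<open>H\<^sub>0 - z\<close>\<close>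

text \<open>The branch of the square root with cut along \<open>[0,\<infinity>)\<close>; \<^const>\<open>Arg2pi\<close> has values in
  \<open>[0,2\<pi>)\<close>.\<close>

definition sqrt2pi :: "complex \<Rightarrow> complex" where
  "sqrt2pi z = complex_of_real (sqrt (cmod z)) * exp (\<i> * complex_of_real (Arg2pi z / 2))"

text \<open>In the next two definitions \<open>E\<close> is meant to be the spectral family of \<open>H\<^sub>0\<close>.\<close>

definition half_power ::
    "(real set \<Rightarrow> 'a::chilbert_space \<Rightarrow> 'a) \<Rightarrow> 'a oper \<Rightarrow> complex \<Rightarrow> 'a oper" where
  "half_power E H0 z =
     spectral_integral_on E {t. complex_of_real t \<in> spectrum H0}
       (\<lambda>t. sqrt2pi (complex_of_real t - z))"

definition neg_half_power ::
    "(real set \<Rightarrow> 'a::chilbert_space \<Rightarrow> 'a) \<Rightarrow> 'a oper \<Rightarrow> complex \<Rightarrow> 'a oper" where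
  "neg_half_power E H0 z =
     spectral_integral_on E {t. complex_of_real t \<in> spectrum H0}
       (\<lambda>t. inverse (sqrt2pi (complex_of_real t - z)))"


section \<open>The scale of spaces\<close>

definition H_plus :: "(real set \<Rightarrow> 'a::chilbert_space \<Rightarrow> 'a) \<Rightarrow> 'a oper \<Rightarrow> 'a set" where
  "H_plus E H0 = dom (half_power E H0 0)"

definition cinner_plus ::
    "(real set \<Rightarrow> 'a::chilbert_space \<Rightarrow> 'a) \<Rightarrow> 'a oper \<Rightarrow> 'a \<Rightarrow> 'a \<Rightarrow> complex" where
  "cinner_plus E H0 f g =
     cinner (app (half_power E H0 0) f) (app (half_power E H0 0) g) + cinner f g"

definition norm_plus :: "(real set \<Rightarrow> 'a::chilbert_space \<Rightarrow> 'a) \<Rightarrow> 'a oper \<Rightarrow> 'a \<Rightarrow> real" where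
  "norm_plus E H0 f = sqrt (Re (cinner_plus E H0 f f))"

text \<open>
  Bounded conjugate linear functionals on \<open>H_plus\<close>.  As functions on the whole type they are
  normalised to vanish outside \<open>H_plus\<close>, so that equality is equality of functionals and the
  vector space operations are pointwise.
\<close>

definition H_minus ::
    "(real set \<Rightarrow> 'a::chilbert_space \<Rightarrow> 'a) \<Rightarrow> 'a oper \<Rightarrow> ('a \<Rightarrow> complex) set" where
  "H_minus E H0 = {\<Psi>.
     (\<forall>g. g \<notin> H_plus E H0 \<longrightarrow> \<Psi> g = 0) \<and>
     (\<forall>f\<in>H_plus E H0. \<forall>g\<in>H_plus E H0. \<Psi> (f + g) = \<Psi> f + \<Psi> g) \<and>
     (\<forall>c. \<forall>g\<in>H_plus E H0. \<Psi> (c *\<^sub>C g) = cnj c * \<Psi> g) \<and>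
     (\<exists>K. \<forall>g\<in>H_plus E H0. cmod (\<Psi> g) \<le> K * norm_plus E H0 g)}"

definition norm_minus ::
    "(real set \<Rightarrow> 'a::chilbert_space \<Rightarrow> 'a) \<Rightarrow> 'a oper \<Rightarrow> ('a \<Rightarrow> complex) \<Rightarrow> real" where
  "norm_minus E H0 \<Psi> = (SUP g \<in> {g \<in> H_plus E H0. norm_plus E H0 g \<le> 1}. cmod (\<Psi> g))"

definition bounded_linear_plus_minus ::
    "(real set \<Rightarrow> 'a::chilbert_space \<Rightarrow> 'a) \<Rightarrow> 'a oper \<Rightarrow> ('a \<Rightarrow> 'a \<Rightarrow> complex) \<Rightarrow> bool" where
  "bounded_linear_plus_minus E H0 V \<longleftrightarrow>
     (\<forall>f\<in>H_plus E H0. V f \<in> H_minus E H0) \<and>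
     (\<forall>f\<in>H_plus E H0. \<forall>g\<in>H_plus E H0. V (f + g) = (\<lambda>h. V f h + V g h)) \<and>
     (\<forall>c. \<forall>f\<in>H_plus E H0. V (c *\<^sub>C f) = (\<lambda>h. c * V f h)) \<and>
     (\<exists>K. \<forall>f\<in>H_plus E H0. norm_minus E H0 (V f) \<le> K * norm_plus E H0 f)"

text \<open>The extension of \<open>(H\<^sub>0 - z I)\<^bsup>-1/2\<^esup>\<close> to \<open>H_minus\<close>.\<close>

definition neg_half_power_ext ::
    "(real set \<Rightarrow> 'a::chilbert_space \<Rightarrow> 'a) \<Rightarrow> 'a oper \<Rightarrow> complex \<Rightarrow> ('a \<Rightarrow> complex) \<Rightarrow> 'a" where
  "neg_half_power_ext E H0 z \<Psi> =
     (THE f. \<forall>g. cinner g f = \<Psi> (app (adjoint_op (neg_half_power E H0 z)) g))"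


section \<open>The operators \<open>A\<^sub>V(z)\<close> and \<open>R(z)\<close>\<close>

definition A_op ::
    "(real set \<Rightarrow> 'a::chilbert_space \<Rightarrow> 'a) \<Rightarrow> 'a oper \<Rightarrow> ('a \<Rightarrow> 'a \<Rightarrow> complex) \<Rightarrow>
     complex \<Rightarrow> 'a \<Rightarrow> 'a" where
  "A_op E H0 V z f = - neg_half_power_ext E H0 z (V (app (neg_half_power E H0 z) f))"

definition D_set ::
    "(real set \<Rightarrow> 'a::chilbert_space \<Rightarrow> 'a) \<Rightarrow> 'a oper \<Rightarrow> ('a \<Rightarrow> 'a \<Rightarrow> complex) \<Rightarrow>
     complex set" where
  "D_set E H0 V = {z \<in> resolvent_set H0. 1 \<notin> resolvent_set (\<lambda>f. Some (A_op E H0 V z f))}"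

definition R_op ::
    "(real set \<Rightarrow> 'a::chilbert_space \<Rightarrow> 'a) \<Rightarrow> 'a oper \<Rightarrow> ('a \<Rightarrow> 'a \<Rightarrow> complex) \<Rightarrow>
     complex \<Rightarrow> 'a \<Rightarrow> 'a" where
  "R_op E H0 V z f =
     app (neg_half_power E H0 z)
       (inv (\<lambda>g. g - A_op E H0 V z g) (app (neg_half_power E H0 z) f))"

end

theory Submission
  imports Defs
begin

text \<open>
  Write \<open>N z\<close> for \<open>(H0 - z)\<^sup>-\<^sup>1\<^sup>/\<^sup>2\<close>.  Formally, \<open>(H0 + V) f = h\<close> means that \<open>(H0 - z) f + V f = h - z f\<close>.
  Putting \<open>f = N z u\<close> and applying \<open>N z\<close> to this equation in \<open>\<H>\<^sub>-\<^sub>1\<close> turns it into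
  \<open>u - A z u = N z (h - z f)\<close>, an equation between vectors of the Hilbert space that involves bounded
  operators only.  The operator \<open>H\<close> is defined by this equation at one point.

  The reason why \<open>H\<close> does not depend on the point is the bounded operator
  \<open>Q z w = (H0 - w)\<^sup>1\<^sup>/\<^sup>2 (H0 - z)\<^sup>-\<^sup>1\<^sup>/\<^sup>2\<close>.  It satisfies \<open>N z = Q z w \<circ> N w = N w \<circ> Q z w\<close> and
  \<open>A z = Q z w \<circ> A w \<circ> Q z w\<close>, it has the inverse \<open>Q w z\<close>, and
  \<open>(Q z w)\<^sup>2 = I + (z - w) (N z)\<^sup>2\<close>.  The identity for \<open>A\<close> carries compactness of \<open>A w\<close> to every other
  point (\<open>compact_A_op\<close>), and all of them together carry the defining equation from \<open>w\<close> to \<open>z\<close>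
  (\<open>graph_at_change_point\<close>).  Whenever \<open>I - A z\<close> is invertible, solving the equation at \<open>z\<close> for \<open>f\<close>
  with \<open>h = k + z f\<close> gives \<open>f = R(z) k\<close>, which says \<open>R(z) = (H - z)\<^sup>-\<^sup>1\<close> (\<open>perturbed_is_resolvent_at\<close>).

  At the negative point where \<open>\<parallel>A\<parallel> < 1\<close> the inverse of \<open>I - A\<close> exists by the contraction principle.
  There the range of \<open>R\<close> is dense, because \<open>R\<close> is a composition of maps with dense range; linearity
  and closedness of \<open>H\<close> are inherited from \<open>R\<close>.  Also there, \<open>R - (H0 - z)\<^sup>-\<^sup>1 = N A (I - A)\<^sup>-\<^sup>1 N\<close> is
  compact, and the resolvent identity for \<open>H\<close> and for \<open>H0\<close> extends this to all common points of the two
  resolvent sets (\<open>compact_resolvent_difference_transfer\<close>), including those where \<open>I - A z\<close> might fail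
  to be invertible.

  All identities for \<open>N\<close> and \<open>Q\<close> are identities between their symbols, by the functional calculus
  \<open>\<phi> \<mapsto> \<integral> \<phi> dE\<close>.  The calculus is multiplicative on bounded Borel functions (\<open>spec_int_mult\<close>), it
  turns bounded pointwise convergence of functions into strong convergence of operators
  (\<open>spec_int_dominated\<close>), and two rules connect it to unbounded integrands
  (\<open>spectral_integral_of_spec_int\<close> and \<open>spec_int_of_spectral_integral\<close>).  The symbols are cut off to
  the spectrum, which is harmless since the spectral family vanishes off the spectrum
  (\<open>E_off_spectrum\<close>), and which makes them bounded.
\<close>

section \<open>Complex inner products\<close>

lemma cinner_add_left: "cinner (x + y) z = cinner x z + cinner (y::'a::chilbert_space) z"
  by (metis cinner_commute cinner_add_right complex_cnj_add)

lemma cinner_scaleC_left: "cinner (c *\<^sub>C x) y = cnj c * cinner (x::'a::chilbert_space) y"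
  by (metis cinner_commute cinner_scaleC_right complex_cnj_mult)

lemma bounded_bilinear_scaleC: "bounded_bilinear ((*\<^sub>C) :: complex \<Rightarrow> 'a \<Rightarrow> 'a::chilbert_space)"
  and norm_scaleC: "norm (c *\<^sub>C (x::'a)) = cmod c * norm x"
proof -
  have norm_eq: "norm (c *\<^sub>C x) = cmod c * norm x" for c and x :: 'a
  proof -
    have "(norm (c *\<^sub>C x))\<^sup>2 = Re (cinner (c *\<^sub>C x) (c *\<^sub>C x))"
      by (simp add: Re_cinner power2_norm_eq_inner)
    also have "\<dots> = Re (complex_of_real ((cmod c)\<^sup>2) * cinner x x)"
      by (simp add: cinner_scaleC_left cinner_scaleC_right complex_norm_square mult.assoc
               flip: of_real_power)
    also have "\<dots> = (cmod c * norm x)\<^sup>2"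
      by (simp add: Re_cinner power2_norm_eq_inner power_mult_distrib)
    finally show ?thesis
      by (simp add: power2_eq_imp_eq)
  qed
  show "norm (c *\<^sub>C x) = cmod c * norm x" by (rule norm_eq)
  show "bounded_bilinear ((*\<^sub>C) :: complex \<Rightarrow> 'a \<Rightarrow> 'a)"
  proof
    fix r :: real and a :: complex and b :: 'a
    have r: "r *\<^sub>R y = complex_of_real r *\<^sub>C y" for y :: 'a
      by (simp add: scaleC_of_real)
    show "(r *\<^sub>R a) *\<^sub>C b = r *\<^sub>R (a *\<^sub>C b)"
      by (simp add: r scaleC_scaleC scaleR_conv_of_real)
    show "a *\<^sub>C (r *\<^sub>R b) = r *\<^sub>R (a *\<^sub>C b)"
      by (simp add: r scaleC_scaleC mult.commute)
    show "\<exists>K. \<forall>(a::complex) (b::'a). norm (a *\<^sub>C b) \<le> norm a * norm b * K"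
      by (intro exI[of _ 1]) (simp add: norm_eq)
  qed (rule scaleC_add_left scaleC_add_right)+
qed

interpretation scaleC: bounded_bilinear "(*\<^sub>C) :: complex \<Rightarrow> 'a \<Rightarrow> 'a::chilbert_space"
  by (rule bounded_bilinear_scaleC)

lemma scaleC_one [simp]: "1 *\<^sub>C (x::'a::chilbert_space) = x"
  using scaleC_of_real[of 1 x] by simp

lemma scaleC_minus_one [simp]: "(- 1) *\<^sub>C (x::'a::chilbert_space) = - x"
  by (simp add: scaleC.minus_left)

lemma cinner_self: "cinner x x = complex_of_real ((norm (x::'a::chilbert_space))\<^sup>2)"
proof -
  have "Im (cinner x x) = 0"
    using arg_cong[OF cinner_commute[of x x], of Im] by simp
  then show ?thesis
    by (simp add: complex_eq_iff Re_cinner power2_norm_eq_inner)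
qed

lemma Im_cinner: "Im (cinner x y) = inner (\<i> *\<^sub>C x) (y::'a::chilbert_space)"
  by (simp flip: Re_cinner add: cinner_scaleC_left)

lemma cmod_cinner_le: "cmod (cinner x y) \<le> norm x * norm (y::'a::chilbert_space)"
proof (cases "cinner x y = 0")
  case False
  \<comment> \<open>Rotating \<open>x\<close> by this phase makes the inner product real, which leaves the real inequality.\<close>
  define c where "c = sgn (cinner x y)"
  have "complex_of_real (cmod (cinner x y)) = cnj c * cinner x y"
    using False by (simp add: c_def sgn_eq complex_norm_square[symmetric] field_simps power2_eq_square)
  also have "\<dots> = cinner (c *\<^sub>C x) y"
    by (simp add: cinner_scaleC_left)
  finally have "cmod (cinner x y) = inner (c *\<^sub>C x) y"
    by (metis Re_cinner Re_complex_of_real)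
  also have "\<dots> \<le> norm (c *\<^sub>C x) * norm y"
    by (rule norm_cauchy_schwarz)
  also have "norm (c *\<^sub>C x) = norm x"
    using False by (simp add: norm_scaleC c_def norm_sgn)
  finally show ?thesis .
qed simp

lemma bounded_bilinear_cinner:
  "bounded_bilinear (cinner :: 'a::chilbert_space \<Rightarrow> 'a \<Rightarrow> complex)"
proof
  fix r :: real and a b :: 'a
  have r: "r *\<^sub>R y = complex_of_real r *\<^sub>C y" for y :: 'a
    by (simp add: scaleC_of_real)
  show "cinner (r *\<^sub>R a) b = r *\<^sub>R cinner a b" "cinner a (r *\<^sub>R b) = r *\<^sub>R cinner a b"
    by (simp_all add: r cinner_scaleC_left cinner_scaleC_right scaleR_conv_of_real)
  show "\<exists>K. \<forall>a b::'a. norm (cinner a b) \<le> norm a * norm b * K"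
    by (intro exI[of _ 1]) (simp add: cmod_cinner_le)
qed (rule cinner_add_left cinner_add_right)+

interpretation cinner: bounded_bilinear "cinner :: 'a::chilbert_space \<Rightarrow> 'a \<Rightarrow> complex"
  by (rule bounded_bilinear_cinner)

lemma cinner_eqI: "(\<And>g. cinner g x = cinner g y) \<Longrightarrow> x = (y::'a::chilbert_space)"
  by (metis Re_cinner inner_commute vector_eq_rdot)

text \<open>The quadratic functional \<open>\<parallel>x\<parallel>\<^sup>2 - 2 \<phi> x\<close> is bounded below, and by the parallelogram law
  each of its minimizing sequences is Cauchy.  The first variation at the minimizer is the
  representation.\<close>

lemma Riesz_real:
  fixes \<phi> :: "'a::{real_inner,banach} \<Rightarrow> real"
  assumes "bounded_linear \<phi>"
  obtains f where "\<And>g. \<phi> g = inner f g"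
proof -
  interpret bounded_linear \<phi> by fact
  define J where "J x = (norm x)\<^sup>2 - 2 * \<phi> x" for x
  obtain K where K: "\<And>x. norm (\<phi> x) \<le> norm x * K" using bounded by blast
  have J_lower: "- K\<^sup>2 \<le> J x" for x
  proof -
    have "0 \<le> (norm x - K)\<^sup>2" by simp
    then show ?thesis using K[of x] by (simp add: J_def power2_eq_square algebra_simps)
  qed
  define m where "m = Inf (range J)"
  have bdd: "bdd_below (range J)" by (rule bdd_belowI2[of _ "- K\<^sup>2"]) (rule J_lower)
  have m_le: "m \<le> J x" for x
    unfolding m_def by (rule cInf_lower[OF _ bdd]) simp
  have "\<exists>x. J x < m + 1 / real (Suc n)" for n
  proof -
    have "Inf (range J) < m + 1 / real (Suc n)" by (simp add: m_def)
    then show ?thesis using cInf_lessD[of "range J"] by auto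
  qed
  then obtain x where x: "\<And>n. J (x n) < m + 1 / real (Suc n)" by metis
  have gap: "(norm (a - b))\<^sup>2 \<le> 2 * (J a - m) + 2 * (J b - m)" for a b
  proof -
    have "(norm (a - b))\<^sup>2 = 2 * J a + 2 * J b - 4 * J ((1/2) *\<^sub>R (a + b))"
      by (simp add: J_def scaleR add power2_norm_eq_inner inner_diff_left inner_diff_right
          inner_add_left inner_add_right inner_commute field_simps)
    then show ?thesis using m_le[of "(1/2) *\<^sub>R (a + b)"] by simp
  qed
  have J_lim: "(\<lambda>n. J (x n)) \<longlonglongrightarrow> m"
  proof (rule tendsto_sandwich[of "\<lambda>n. m" _ _ "\<lambda>n. m + 1 / real (Suc n)"])
    show "(\<lambda>n. m + 1 / real (Suc n)) \<longlonglongrightarrow> m"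
      using tendsto_add[OF tendsto_const[of m] LIMSEQ_inverse_real_of_nat]
      by (simp add: inverse_eq_divide)
  qed (use m_le x in \<open>auto intro!: always_eventually less_imp_le simp del: of_nat_Suc\<close>)
  have "Cauchy x"
  proof (rule metric_CauchyI)
    fix e :: real assume e: "e > 0"
    then have "eventually (\<lambda>n. J (x n) < m + e\<^sup>2 / 4) sequentially"
      by (intro order_tendstoD(2)[OF J_lim]) simp
    then obtain N where N: "\<And>n. n \<ge> N \<Longrightarrow> J (x n) < m + e\<^sup>2 / 4"
      by (auto simp: eventually_sequentially)
    show "\<exists>M. \<forall>i\<ge>M. \<forall>j\<ge>M. dist (x i) (x j) < e"
    proof (intro exI allI impI)
      fix i j assume "i \<ge> N" "j \<ge> N"
      then have "(norm (x i - x j))\<^sup>2 < e\<^sup>2"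
        using gap[of "x i" "x j"] N[of i] N[of j] by (simp add: field_simps)
      then show "dist (x i) (x j) < e"
        using e by (simp add: dist_norm power_less_imp_less_base)
    qed
  qed
  then obtain f where f: "x \<longlonglongrightarrow> f" by (meson Cauchy_convergent_iff convergent_def)
  have "(\<lambda>n. J (x n)) \<longlonglongrightarrow> J f"
    unfolding J_def by (intro tendsto_intros tendsto f)
  then have Jf: "J f = m" using J_lim LIMSEQ_unique by blast
  have "\<phi> g = inner f g" for g
  proof (rule ccontr)
    define d where "d = inner f g - \<phi> g"
    assume "\<phi> g \<noteq> inner f g"
    then have d: "d \<noteq> 0" by (simp add: d_def)
    have var: "0 \<le> t\<^sup>2 * (norm g)\<^sup>2 + 2 * t * d" for t
    proof -
      have "J (f + t *\<^sub>R g) = J f + t\<^sup>2 * (norm g)\<^sup>2 + 2 * t * d"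
        unfolding J_def d_def power2_norm_eq_inner
        by (simp add: add scaleR inner_add_left inner_add_right inner_commute power2_eq_square
            algebra_simps)
      then show ?thesis using m_le[of "f + t *\<^sub>R g"] Jf by simp
    qed
    define N where "N = (norm g)\<^sup>2 + 1"
    have pos: "N > 0" by (simp add: N_def add_nonneg_pos)
    \<comment> \<open>the step that minimizes the quadratic \<open>t\<^sup>2 N + 2 t d\<close>\<close>
    define t where "t = - d / N"
    have "t\<^sup>2 * (norm g)\<^sup>2 + 2 * t * d \<le> t\<^sup>2 * N + 2 * t * d"
      by (simp add: N_def algebra_simps)
    also have "\<dots> = - (d\<^sup>2 / N)"
      using pos by (simp add: t_def field_simps power2_eq_square)
    also have "\<dots> < 0" using d pos by simp
    finally show False using var[of t] by simp
  qed
  then show thesis using that by blast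
qed

text \<open>The real part of a conjugate linear functional determines it, since \<open>Im (G g) = Re (G (\<i> g))\<close>.\<close>

lemma Riesz_conjugate_linear:
  fixes G :: "'a::chilbert_space \<Rightarrow> complex"
  assumes add: "\<And>x y. G (x + y) = G x + G y"
    and scale: "\<And>c x. G (c *\<^sub>C x) = cnj c * G x"
    and bound: "\<And>x. cmod (G x) \<le> K * norm x"
  obtains f where "\<And>g. cinner g f = G g"
proof -
  have "bounded_linear (\<lambda>g. Re (G g))"
  proof (rule bounded_linear_intro)
    show "Re (G (r *\<^sub>R x)) = r *\<^sub>R Re (G x)" for r x
      using scale[of "complex_of_real r" x] by (simp add: scaleC_of_real)
    show "norm (Re (G x)) \<le> norm x * K" for x
      using abs_Re_le_cmod[of "G x"] bound[of x] by (simp add: mult.commute)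
  qed (simp add: add)
  then obtain f where f: "\<And>g. Re (G g) = inner f g" using Riesz_real by blast
  have "cinner g f = G g" for g
    using f[of "\<i> *\<^sub>C g"] by (simp add: complex_eq_iff Re_cinner Im_cinner f inner_commute scale)
  then show thesis using that by blast
qed


section \<open>Bounded and compact operators\<close>

lemma bounded_clinearI:
  assumes "\<And>x y. B (x + y) = B x + B y" "\<And>c x. B (c *\<^sub>C x) = c *\<^sub>C B x"
    and "\<And>x. norm (B x) \<le> K * norm x"
  shows "bounded_clinear B"
  unfolding bounded_clinear_def
proof (intro conjI allI)
  show "bounded_linear B"
    using assms by (intro bounded_linear_intro[of _ K]) (auto simp flip: scaleC_of_real simp: mult.commute)
qed (rule assms)

lemma bounded_clinear_bounded_linear: "bounded_clinear B \<Longrightarrow> bounded_linear B"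
  and bounded_clinear_scaleC: "bounded_clinear B \<Longrightarrow> B (c *\<^sub>C x) = c *\<^sub>C B x"
  by (simp_all add: bounded_clinear_def)

lemma bounded_clinear_linear: "bounded_clinear B \<Longrightarrow> linear B"
  by (simp add: bounded_clinear_bounded_linear bounded_linear.linear)

lemmas bounded_clinear_simps =
  linear_add[OF bounded_clinear_linear] linear_diff[OF bounded_clinear_linear]
  linear_neg[OF bounded_clinear_linear] linear_0[OF bounded_clinear_linear]
  bounded_clinear_scaleC

lemma bounded_clinear_bound:
  assumes "bounded_clinear B" obtains K where "K > 0" "\<And>x. norm (B x) \<le> K * norm x"
  using bounded_linear.pos_bounded[OF bounded_clinear_bounded_linear[OF assms]]
  by (metis mult.commute)

lemma bounded_clinear_ident: "bounded_clinear (\<lambda>x. x)"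
  by (simp add: bounded_clinear_def)

lemma bounded_clinear_compose:
  "bounded_clinear A \<Longrightarrow> bounded_clinear B \<Longrightarrow> bounded_clinear (\<lambda>x. A (B x))"
  by (simp add: bounded_clinear_def bounded_linear_compose)

lemma bounded_clinear_add:
  "bounded_clinear A \<Longrightarrow> bounded_clinear B \<Longrightarrow> bounded_clinear (\<lambda>x. A x + B x)"
  by (simp add: bounded_clinear_def bounded_linear_add scaleC.add_right)

lemma bounded_clinear_scaleC_left:
  "bounded_clinear A \<Longrightarrow> bounded_clinear (\<lambda>x. c *\<^sub>C A x)"
  by (simp add: bounded_clinear_def bounded_linear_compose[OF scaleC.bounded_linear_right]
      scaleC_scaleC mult.commute)

lemma bounded_clinear_minus: "bounded_clinear A \<Longrightarrow> bounded_clinear (\<lambda>x. - A x)"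
  using bounded_clinear_scaleC_left[of A "- 1"] by simp

lemma compact_op_compose:
  assumes A: "compact_op A" and B: "bounded_clinear B" and C: "bounded_clinear C"
  shows "compact_op (\<lambda>x. B (A (C x)))"
  unfolding compact_op_def
proof (intro conjI allI impI)
  show "bounded_clinear (\<lambda>x. B (A (C x)))"
    using A B C by (auto simp: compact_op_def intro: bounded_clinear_compose)
next
  fix S :: "'a set" assume "bounded S"
  then have "bounded (C ` S)"
    by (rule bounded_linear_image[OF _ bounded_clinear_bounded_linear[OF C]])
  then have "compact (closure (A ` C ` S))"
    using A unfolding compact_op_def by blast
  then have "compact (B ` closure (A ` C ` S))"
    by (intro compact_continuous_image linear_continuous_on bounded_clinear_bounded_linear[OF B])
  moreover have "(\<lambda>x. B (A (C x))) ` S \<subseteq> B ` closure (A ` C ` S)"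
    using closure_subset[of "A ` C ` S"] by (auto simp: image_image)
  ultimately show "compact (closure ((\<lambda>x. B (A (C x))) ` S))"
    by (metis closed_Int_compact closed_closure closure_minimal compact_imp_closed inf.absorb1)
qed

text \<open>A strict contraction \<open>A\<close> makes \<open>g \<mapsto> k + A g\<close> a contraction, whose fixed point solves
  \<open>(I - A) g = k\<close>.\<close>

lemma bij_ident_minus_contraction:
  fixes A :: "'a::chilbert_space \<Rightarrow> 'a"
  assumes A: "bounded_clinear A" and small: "onorm A < 1"
  shows "bij (\<lambda>g. g - A g)" and "bounded_clinear (inv (\<lambda>g. g - A g))"
proof -
  note [simp] = bounded_clinear_simps[OF A]
  have A_le: "norm (A x) \<le> onorm A * norm x" for x
    by (rule onorm[OF bounded_clinear_bounded_linear[OF A]])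
  have nonneg: "0 \<le> onorm A"
    by (rule onorm_pos_le[OF bounded_clinear_bounded_linear[OF A]])
  have lower: "norm x \<le> norm (x - A x) / (1 - onorm A)" for x
    using norm_triangle_ineq2[of x "A x"] A_le[of x] small by (simp add: field_simps)
  have "\<exists>!g. k + A g = g" for k
  proof (rule banach_fix_type[OF nonneg small], intro allI)
    show "dist (k + A x) (k + A y) \<le> onorm A * dist x y" for x y
      using A_le[of "x - y"] by (simp add: dist_norm)
  qed
  then have "\<exists>!g. k = g - A g" for k by (metis add_diff_cancel_right' diff_add_cancel)
  then show bij: "bij (\<lambda>g. g - A g)"
    unfolding bij_iff by metis
  have inv: "inv (\<lambda>g. g - A g) k - A (inv (\<lambda>g. g - A g) k) = k" for k
    by (rule surj_f_inv_f[OF bij_is_surj[OF bij]])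
  have inv_eqI: "inv (\<lambda>g. g - A g) k = x" if "x - A x = k" for x k
    by (rule inv_f_eq[OF bij_is_inj[OF bij] that])
  show "bounded_clinear (inv (\<lambda>g. g - A g))"
  proof (rule bounded_clinearI)
    show "inv (\<lambda>g. g - A g) (x + y) = inv (\<lambda>g. g - A g) x + inv (\<lambda>g. g - A g) y" for x y
      by (rule inv_eqI) (metis (no_types, lifting) add_diff_add inv linear_add[OF bounded_clinear_linear[OF A]])
    show "inv (\<lambda>g. g - A g) (c *\<^sub>C x) = c *\<^sub>C inv (\<lambda>g. g - A g) x" for c x
      by (rule inv_eqI) (simp flip: scaleC.diff_right add: inv)
    show "norm (inv (\<lambda>g. g - A g) x) \<le> (1 / (1 - onorm A)) * norm x" for x
      using lower[of "inv (\<lambda>g. g - A g) x"] by (simp add: inv)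
  qed
qed


section \<open>Resolvents\<close>

lemma shift_op_eq_Some: "shift_op T z f = Some k \<longleftrightarrow> T f = Some (k + z *\<^sub>C f)"
  by (cases "T f") (auto simp: shift_op_def algebra_simps)

text \<open>The graph form of \<open>B = (T - z)\<^sup>-\<^sup>1\<close>: it replaces injectivity, range and inverse of a partial map by
  one equivalence between equations.\<close>

lemma is_resolvent_at_iff:
  "is_resolvent_at T z B \<longleftrightarrow> (\<forall>k f. T f = Some (k + z *\<^sub>C f) \<longleftrightarrow> f = B k)"
proof -
  define S where "S = shift_op T z"
  have "injective_op S \<and> inverse_op S = (\<lambda>h. Some (B h)) \<longleftrightarrow> (\<forall>k f. S f = Some k \<longleftrightarrow> f = B k)"
    (is "?L \<longleftrightarrow> ?R")
  proof
    assume L: ?L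
    have inj: "f = g" if "S f = Some k" "S g = Some k" for f g k
      using L that by (auto simp: injective_op_def inj_on_def dom_def)
    have "k \<in> ran S \<and> (THE f. S f = Some k) = B k" for k
      using L by (auto simp: inverse_op_def fun_eq_iff split: if_splits)
    moreover have "(THE f. S f = Some k) = f" if "S f = Some k" for f k
      using that by (rule the_equality) (rule inj[OF _ that])
    ultimately have "S (B k) = Some k" for k
      unfolding ran_def by force
    then show ?R using inj by blast
  next
    assume R: ?R
    then have "(THE f. S f = Some k) = B k" for k by simp
    moreover have "k \<in> ran S" for k using R by (auto simp: ran_def)
    moreover have "injective_op S"
      using R unfolding injective_op_def inj_on_def dom_def by (metis (mono_tags) mem_Collect_eq not_None_eq)
    ultimately show ?L
      by (simp add: inverse_op_def)
  qed
  then show ?thesis by (simp add: is_resolvent_at_def S_def shift_op_eq_Some)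
qed

lemma is_resolvent_at_imp_resolvent: "is_resolvent_at T z B \<Longrightarrow> resolvent T z = B"
  by (simp add: is_resolvent_at_def resolvent_def app_def fun_eq_iff)

lemma resolvent_set_iff:
  "z \<in> resolvent_set T \<longleftrightarrow> is_resolvent_at T z (resolvent T z) \<and> bounded_clinear (resolvent T z)"
  by (auto simp: resolvent_set_def is_resolvent_at_def resolvent_def inverse_op_def fun_eq_iff app_def
      split: if_splits)

lemma resolvent_setI:
  "is_resolvent_at T z B \<Longrightarrow> bounded_clinear B \<Longrightarrow> z \<in> resolvent_set T"
  by (simp add: resolvent_set_iff is_resolvent_at_imp_resolvent)

lemma is_resolvent_at_unique:
  assumes "is_resolvent_at T z B" "is_resolvent_at T' z B"
  shows "T = T'"
proof
  fix f
  have "T f = Some h \<longleftrightarrow> T' f = Some h" for h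
    using assms[unfolded is_resolvent_at_iff, rule_format, of f "h - z *\<^sub>C f"] by simp
  then show "T f = T' f"
    by (metis not_None_eq)
qed

text \<open>The resolvent of \<open>A\<close> at \<open>1\<close> is \<open>(A - I)\<^sup>-\<^sup>1\<close>, the negative of \<open>(I - A)\<^sup>-\<^sup>1\<close>.\<close>

lemma one_in_resolvent_set_iff:
  assumes A: "bounded_clinear A"
  shows "1 \<in> resolvent_set (\<lambda>f. Some (A f)) \<longleftrightarrow>
    bij (\<lambda>g. g - A g) \<and> bounded_clinear (inv (\<lambda>g. g - A g))" (is "?L \<longleftrightarrow> ?R")
proof
  assume ?L
  then obtain B where B: "\<And>k f. A f = k + f \<longleftrightarrow> f = B k" and bc: "bounded_clinear B"
    by (auto simp: resolvent_set_iff is_resolvent_at_iff)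
  have eq: "k = g - A g \<longleftrightarrow> g = - B k" for k g
  proof -
    have "k = g - A g \<longleftrightarrow> A (- g) = k + - g"
      by (auto simp: bounded_clinear_simps[OF A] algebra_simps)
    then show ?thesis using B[of "- g" k] minus_equation_iff[of g "B k"] by argo
  qed
  then have bij: "bij (\<lambda>g. g - A g)" unfolding bij_iff by metis
  moreover have "inv (\<lambda>g. g - A g) = (\<lambda>k. - B k)"
    by (intro ext inv_f_eq bij_is_inj[OF bij]) (metis eq)
  ultimately show ?R using bc by (simp add: bounded_clinear_minus)
next
  assume R: ?R
  then have inv: "k = g - A g \<longleftrightarrow> g = inv (\<lambda>g. g - A g) k" for k g
    using bij_inv_eq_iff[of "\<lambda>g. g - A g" g k] by metis
  have "A f = k + f \<longleftrightarrow> f = - inv (\<lambda>g. g - A g) k" for k f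
  proof -
    have "A f = k + f \<longleftrightarrow> k = - f - A (- f)"
      by (auto simp: bounded_clinear_simps[OF A] algebra_simps)
    then show ?thesis using inv[of k "- f"] minus_equation_iff[of f "inv (\<lambda>g. g - A g) k"] by argo
  qed
  then show ?L
    using R by (intro resolvent_setI[of _ _ "\<lambda>k. - inv (\<lambda>g. g - A g) k"])
      (auto simp: is_resolvent_at_iff intro: bounded_clinear_minus)
qed

text \<open>An operator with a bounded resolvent inherits linearity and closedness from it.\<close>

lemma is_resolvent_at_imp_linear_closed:
  assumes res: "is_resolvent_at T z B" and B: "bounded_clinear B"
  shows "linear_op T" "closed_op T" "dom T = range B"
proof -
  note lin = bounded_clinear_simps[OF B]
  have graph: "T f = Some h \<longleftrightarrow> f = B (h - z *\<^sub>C f)" for f h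
    using res[unfolded is_resolvent_at_iff, rule_format, of f "h - z *\<^sub>C f"] by simp
  have appI: "T f = Some (app T f)" if "f \<in> dom T" for f
    using that by (auto simp: app_def)
  show "linear_op T"
    unfolding linear_op_def
  proof (intro conjI ballI allI)
    show "0 \<in> dom T" using graph[of 0 0] by (auto simp: lin scaleC.zero_right)
    show "T (f + g) = Some (app T f + app T g)" if "f \<in> dom T" "g \<in> dom T" for f g
    proof -
      have "f = B (app T f - z *\<^sub>C f)" "g = B (app T g - z *\<^sub>C g)"
        using appI that graph by blast+
      then have "f + g = B (app T f - z *\<^sub>C f) + B (app T g - z *\<^sub>C g)" by simp
      also have "\<dots> = B (app T f + app T g - z *\<^sub>C (f + g))"
        by (simp add: lin scaleC.add_right)
      finally show ?thesis by (simp add: graph)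
    qed
    show "T (c *\<^sub>C f) = Some (c *\<^sub>C app T f)" if "f \<in> dom T" for c f
    proof -
      have "f = B (app T f - z *\<^sub>C f)" using appI that graph by blast
      then have "c *\<^sub>C f = c *\<^sub>C B (app T f - z *\<^sub>C f)" by simp
      also have "\<dots> = B (c *\<^sub>C app T f - z *\<^sub>C (c *\<^sub>C f))"
        by (simp add: lin scaleC.diff_right scaleC_scaleC mult.commute)
      finally show ?thesis by (simp add: graph)
    qed
  qed
  have cont: "continuous_on S B" for S
    by (rule linear_continuous_on[OF bounded_clinear_bounded_linear[OF B]])
  have "closed {p. fst p = B (snd p - z *\<^sub>C fst p)}"
    by (intro closed_Collect_eq continuous_intros continuous_on_compose2[OF cont[of UNIV]]
        bounded_bilinear.continuous_on[OF bounded_bilinear_scaleC]) auto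
  moreover have "{(f, h). T f = Some h} = {p. fst p = B (snd p - z *\<^sub>C fst p)}"
    using graph by auto
  ultimately show "closed_op T" by (simp add: closed_op_def)
  show "dom T = range B"
  proof (intro equalityI subsetI)
    fix f assume "f \<in> dom T"
    then obtain h where "T f = Some h" by auto
    then show "f \<in> range B" using graph by blast
  next
    fix f assume "f \<in> range B"
    then obtain k where "f = B k" by auto
    then have "T f = Some (k + z *\<^sub>C f)" using res by (simp add: is_resolvent_at_iff)
    then show "f \<in> dom T" by auto
  qed
qed

text \<open>The resolvent identity factors the difference of two resolvents at \<open>z\<close> through the
  difference at \<open>w\<close>:
  \<open>R\<^sub>z - S\<^sub>z = (I + (z - w) R\<^sub>z) (R\<^sub>w - S\<^sub>w) (I + (z - w) S\<^sub>z)\<close>.\<close>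

lemma compact_resolvent_difference_transfer:
  assumes T: "z \<in> resolvent_set T" "w \<in> resolvent_set T"
    and S: "z \<in> resolvent_set S" "w \<in> resolvent_set S"
    and compact: "compact_op (\<lambda>f. resolvent T w f - resolvent S w f)"
  shows "compact_op (\<lambda>f. resolvent T z f - resolvent S z f)"
proof -
  define D where "D f = resolvent T w f - resolvent S w f" for f
  have bT: "bounded_clinear (resolvent T z)" and bS: "bounded_clinear (resolvent S z)"
    using T S by (simp_all add: resolvent_set_iff)
  have res: "U f = Some (k + u *\<^sub>C f) \<longleftrightarrow> f = resolvent U u k" if "u \<in> resolvent_set U" for U u f and k :: 'a
    using that by (simp add: resolvent_set_iff is_resolvent_at_iff)
  have T_id: "resolvent T w k = resolvent T z k + (w - z) *\<^sub>C resolvent T z (resolvent T w k)" for k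
  proof -
    have "T (resolvent T w k) = Some ((k + (w - z) *\<^sub>C resolvent T w k) + z *\<^sub>C resolvent T w k)"
      using res[OF T(2), of "resolvent T w k" k] by (simp add: scaleC.diff_left)
    then show ?thesis using res[OF T(1)] by (simp add: bounded_clinear_simps[OF bT])
  qed
  have S_id: "resolvent S z k = resolvent S w (k + (z - w) *\<^sub>C resolvent S z k)" for k
  proof -
    have "S (resolvent S z k) = Some ((k + (z - w) *\<^sub>C resolvent S z k) + w *\<^sub>C resolvent S z k)"
      using res[OF S(1), of "resolvent S z k" k] by (simp add: scaleC.diff_left)
    then show ?thesis using res[OF S(2)] by simp
  qed
  have "resolvent T z f - resolvent S z f =
      (\<lambda>x. x + (z - w) *\<^sub>C resolvent T z x) (D (f + (z - w) *\<^sub>C resolvent S z f))" for f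
  proof -
    define k where "k = f + (z - w) *\<^sub>C resolvent S z f"
    have "resolvent T w k + (z - w) *\<^sub>C resolvent T z (resolvent T w k) = resolvent T z k"
      using T_id[of k] by (simp add: scaleC.diff_left algebra_simps)
    moreover have "resolvent T z k = resolvent T z f + (z - w) *\<^sub>C resolvent T z (resolvent S z f)"
      by (simp add: k_def bounded_clinear_simps[OF bT])
    moreover have "resolvent S w k = resolvent S z f"
      using S_id[of f] by (simp add: k_def)
    ultimately show ?thesis
      by (simp add: D_def flip: k_def)
        (simp add: bounded_clinear_simps[OF bT] scaleC.diff_right algebra_simps)
  qed
  then show ?thesis
    using compact_op_compose[of D "\<lambda>x. x + (z - w) *\<^sub>C resolvent T z x"
        "\<lambda>f. f + (z - w) *\<^sub>C resolvent S z f"] compact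
    by (simp add: D_def[abs_def] bounded_clinear_add bounded_clinear_ident bounded_clinear_scaleC_left bT bS)
qed


section \<open>Projection-valued measures\<close>

locale spectral_resolution =
  fixes E :: "real set \<Rightarrow> 'a::chilbert_space \<Rightarrow> 'a"
  assumes pvm: "projection_valued_measure E"
begin

lemma E_bounded_clinear: "B \<in> sets borel \<Longrightarrow> bounded_clinear (E B)"
  and E_idem: "B \<in> sets borel \<Longrightarrow> E B (E B f) = E B f"
  and E_selfadjoint: "B \<in> sets borel \<Longrightarrow> cinner g (E B f) = cinner (E B g) f"
  and E_UNIV: "E UNIV f = f"
  and E_sums: "range A \<subseteq> sets borel \<Longrightarrow> disjoint_family A \<Longrightarrow>
    (\<lambda>n::nat. E (A n) f) sums E (\<Union>n. A n) f"
  using pvm unfolding projection_valued_measure_def by (auto simp: fun_eq_iff)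

lemma E_empty [simp]: "E {} f = 0"
proof -
  have "(\<lambda>n::nat. E {} f) sums E {} f"
    using E_sums[of "\<lambda>_. {}"] by (simp add: disjoint_family_on_def)
  then show ?thesis
    using sums_summable summable_LIMSEQ_zero LIMSEQ_unique[OF tendsto_const] by blast
qed

lemma E_Un:
  assumes "A \<in> sets borel" "B \<in> sets borel" "A \<inter> B = {}"
  shows "E (A \<union> B) f = E A f + E B f"
proof -
  define C where "C n = (if n = 0 then A else if n = 1 then B else {})" for n :: nat
  have "(\<lambda>n. E (C n) f) sums E (\<Union>n. C n) f"
    using assms by (intro E_sums) (auto simp: C_def disjoint_family_on_def)
  moreover have "(\<lambda>n. E (C n) f) sums (\<Sum>n\<in>{0,1}. E (C n) f)"
    by (rule sums_finite) (auto simp: C_def)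
  moreover have "(\<Union>n. C n) = A \<union> B"
    by (auto simp: C_def split: if_splits)
  ultimately show ?thesis
    by (auto simp: C_def dest: sums_unique2)
qed

lemma norm_E_sq: "B \<in> sets borel \<Longrightarrow> complex_of_real ((norm (E B f))\<^sup>2) = cinner f (E B f)"
  by (metis E_idem E_selfadjoint cinner_self)

lemma norm_E_le: "B \<in> sets borel \<Longrightarrow> norm (E B f) \<le> norm f"
proof -
  assume B: "B \<in> sets borel"
  have "(norm (E B f))\<^sup>2 = cmod (cinner f (E B f))"
    by (metis norm_E_sq[OF B] norm_of_real abs_power2)
  also have "\<dots> \<le> norm f * norm (E B f)"
    by (rule cmod_cinner_le)
  finally show ?thesis
    by (cases "E B f = 0") (auto simp: power2_eq_square)
qed

text \<open>For \<open>f = E B f\<close> one has \<open>\<parallel>f\<parallel>\<^sup>2 \<ge> \<parallel>E (A \<union> B) f\<parallel>\<^sup>2 = \<parallel>E A f\<parallel>\<^sup>2 + \<parallel>f\<parallel>\<^sup>2\<close>.\<close>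

lemma E_disjoint:
  assumes A: "A \<in> sets borel" and B: "B \<in> sets borel" and disj: "A \<inter> B = {}"
  shows "E A (E B f) = 0"
proof -
  define g where "g = E B f"
  have "complex_of_real ((norm (E (A \<union> B) g))\<^sup>2) = cinner g (E A g) + cinner g (E B g)"
    using A B disj by (subst norm_E_sq) (auto simp: E_Un cinner.add_right)
  also have "\<dots> = complex_of_real ((norm (E A g))\<^sup>2 + (norm g)\<^sup>2)"
    by (simp only: norm_E_sq[OF A, symmetric] norm_E_sq[OF B, symmetric] of_real_add)
      (simp add: g_def E_idem[OF B])
  finally have "(norm (E (A \<union> B) g))\<^sup>2 = (norm (E A g))\<^sup>2 + (norm g)\<^sup>2"
    by (simp only: of_real_eq_iff)
  moreover have "(norm (E (A \<union> B) g))\<^sup>2 \<le> (norm g)\<^sup>2"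
    using A B by (intro power_mono norm_E_le) auto
  ultimately show ?thesis by (simp add: g_def)
qed

lemma E_Int:
  assumes A: "A \<in> sets borel" and B: "B \<in> sets borel"
  shows "E A (E B f) = E (A \<inter> B) f"
proof -
  have eq: "E X g = E (X \<inter> Y) g + E (X - Y) g" if "X \<in> sets borel" "Y \<in> sets borel" for X Y g
    using that E_Un[of "X \<inter> Y" "X - Y" g] by (simp add: Int_Diff_Un Int_Diff_disjoint)
  have "E A (E B f) = E (A \<inter> B) (E B f)"
    using eq[OF A B, of "E B f"] A B by (simp add: E_disjoint[of "A - B" B] Diff_disjoint Int_commute)
  also have "\<dots> = E (A \<inter> B) (E (A \<inter> B) f) + E (A \<inter> B) (E (B - A) f)"
    using eq[OF B A, of f] A B
    by (simp add: bounded_clinear_simps[OF E_bounded_clinear] Int_commute)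
  also have "\<dots> = E (A \<inter> B) f"
    using A B by (simp add: E_idem) (rule E_disjoint, auto)
  finally show ?thesis .
qed

lemma E_UN_finite:
  assumes "finite I" "\<And>i. i \<in> I \<Longrightarrow> A i \<in> sets borel" "disjoint_family_on A I"
  shows "E (\<Union>i\<in>I. A i) f = (\<Sum>i\<in>I. E (A i) f)"
  using assms
proof (induction I)
  case (insert i I)
  then have "E (A i \<union> (\<Union>i\<in>I. A i)) f = E (A i) f + E (\<Union>i\<in>I. A i) f"
    by (intro E_Un) (auto simp: disjoint_family_on_def)
  then show ?case
    using insert by (simp add: disjoint_family_on_insert)
qed simp

abbreviation spectral_measure ("\<mu>") where "\<mu> \<equiv> spectral_measure_at E"

lemma space_spectral_measure [simp]: "space (\<mu> f) = UNIV"
  and sets_spectral_measure [measurable_cong, simp]: "sets (\<mu> f) = sets borel"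
  unfolding spectral_measure_at_def
  using sets.sigma_algebra_axioms[of "borel :: real measure"]
  by (auto simp: space_measure_of_conv sets_measure_of_conv sigma_algebra.sigma_sets_eq)

lemma emeasure_spectral_measure:
  assumes "B \<in> sets borel"
  shows "emeasure (\<mu> f) B = ennreal ((norm (E B f))\<^sup>2)"
proof (rule emeasure_measure_of[OF spectral_measure_at_def])
  show "countably_additive (sets (\<mu> f)) (\<lambda>B. ennreal ((norm (E B f))\<^sup>2))"
  proof (rule countably_additiveI)
    fix A :: "nat \<Rightarrow> real set"
    assume "range A \<subseteq> sets (\<mu> f)" and disj: "disjoint_family A"
    then have A: "range A \<subseteq> sets borel" "\<And>i. A i \<in> sets borel" by auto
    \<comment> \<open>Pythagoras, in the form \<open>\<parallel>E B f\<parallel>\<^sup>2 = (f, E B f)\<close> with \<open>E B f\<close> additive in \<open>B\<close>.\<close>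
    have partial: "(\<Sum>i<n. (norm (E (A i) f))\<^sup>2) = (norm (\<Sum>i<n. E (A i) f))\<^sup>2" for n
    proof -
      have UN: "E (\<Union>i<n. A i) f = (\<Sum>i<n. E (A i) f)"
        using A disj by (intro E_UN_finite) (auto simp: disjoint_family_on_def)
      have "complex_of_real (\<Sum>i<n. (norm (E (A i) f))\<^sup>2) = (\<Sum>i<n. cinner f (E (A i) f))"
        using A by (simp add: norm_E_sq flip: of_real_power)
      also have "\<dots> = cinner f (E (\<Union>i<n. A i) f)"
        by (simp add: UN cinner.sum_right)
      also have "\<dots> = complex_of_real ((norm (E (\<Union>i<n. A i) f))\<^sup>2)"
        using A by (intro norm_E_sq[symmetric]) auto
      finally show ?thesis by (simp only: UN of_real_eq_iff)
    qed
    have "(\<lambda>n. (norm (\<Sum>i<n. E (A i) f))\<^sup>2) \<longlonglongrightarrow> (norm (E (\<Union>i. A i) f))\<^sup>2"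
      using E_sums[OF A(1) disj, of f] unfolding sums_def by (intro tendsto_intros)
    then have "(\<lambda>i. (norm (E (A i) f))\<^sup>2) sums (norm (E (\<Union>i. A i) f))\<^sup>2"
      unfolding sums_def partial .
    then show "(\<Sum>i. ennreal ((norm (E (A i) f))\<^sup>2)) = ennreal ((norm (E (\<Union>i. A i) f))\<^sup>2)"
      by (intro suminf_ennreal_eq) auto
  qed
qed (use assms in \<open>auto simp: positive_def\<close>)

lemma E_null_iff: "B \<in> sets borel \<Longrightarrow> E B f = 0 \<longleftrightarrow> B \<in> null_sets (\<mu> f)"
  by (simp add: null_sets_def emeasure_spectral_measure ennreal_eq_0_iff)

lemma E_null_UN:
  assumes "countable I" "\<And>i. i \<in> I \<Longrightarrow> A i \<in> sets borel" "\<And>i. i \<in> I \<Longrightarrow> E (A i) f = 0"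
  shows "E (\<Union>i\<in>I. A i) f = 0"
proof -
  have "(\<Union>i\<in>I. A i) \<in> null_sets (\<mu> f)"
    using assms by (intro null_sets_UN') (auto simp: E_null_iff)
  moreover from this have "(\<Union>i\<in>I. A i) \<in> sets borel"
    using null_setsD2 by fastforce
  ultimately show ?thesis by (simp add: E_null_iff)
qed


section \<open>Spectral integrals of simple functions\<close>

abbreviation "simple \<equiv> simple_function (borel :: real measure)"
abbreviation "simple_int \<equiv> simple_spectral_integral E"

lemma simple_finite: "simple p \<Longrightarrow> finite (range p)"
  and simple_vimage: "simple p \<Longrightarrow> p -` {b} \<in> sets borel"
proof -
  assume p: "simple p"
  then show "finite (range p)" by (simp add: simple_function_def)
  show "p -` {b} \<in> sets borel"
  proof (cases "b \<in> range p")
    case True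
    then show ?thesis using p unfolding simple_function_def by auto
  next
    case False
    then have "p -` {b} = {}" by auto
    then show ?thesis by simp
  qed
qed

text \<open>A simple function may be integrated along any finite measurable partition on whose cells it is
  constant.  Refining two simple functions to a common partition reduces the algebra of the
  simple integral to sums over one index set.\<close>

lemma simple_int_comp:
  assumes p: "simple p"
  shows "simple_int (\<lambda>t. G (p t)) f = (\<Sum>b\<in>range p. G b *\<^sub>C E (p -` {b}) f)"
proof -
  have "E ((\<lambda>t. G (p t)) -` {c}) f = (\<Sum>b\<in>{b \<in> range p. G b = c}. E (p -` {b}) f)" for c
  proof -
    have "(\<lambda>t. G (p t)) -` {c} = (\<Union>b\<in>{b \<in> range p. G b = c}. p -` {b})" by auto
    then show ?thesis
      using simple_finite[OF p] by (auto intro!: E_UN_finite simple_vimage[OF p] simp: disjoint_family_on_def)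
  qed
  then have "simple_int (\<lambda>t. G (p t)) f =
      (\<Sum>c\<in>G ` range p. \<Sum>b\<in>{b \<in> range p. G b = c}. G b *\<^sub>C E (p -` {b}) f)"
    by (simp add: simple_spectral_integral_def image_image scaleC.sum_right)
  also have "\<dots> = (\<Sum>b\<in>range p. G b *\<^sub>C E (p -` {b}) f)"
    by (rule sum.image_gen[symmetric, OF simple_finite[OF p]])
  finally show ?thesis .
qed

lemma simple_int_add:
  assumes "simple s" "simple s'"
  shows "simple_int (\<lambda>t. s t + s' t) f = simple_int s f + simple_int s' f"
proof -
  have p: "simple (\<lambda>t. (s t, s' t))" using assms by (rule simple_function_Pair)
  show ?thesis
    using simple_int_comp[OF p, of "\<lambda>b. fst b + snd b" f] simple_int_comp[OF p, of fst f]
      simple_int_comp[OF p, of snd f]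
    by (simp add: scaleC.add_left sum.distrib)
qed

lemma simple_int_bounded_clinear:
  assumes s: "simple s"
  shows "bounded_clinear (simple_int s)"
proof -
  have "bounded_clinear (\<lambda>f. \<Sum>c\<in>S. c *\<^sub>C E (s -` {c}) f)" if "finite S" for S
    using that
  proof (induction S)
    case empty
    show ?case by (simp add: bounded_clinear_def scaleC.zero_right)
  next
    case (insert c S)
    then show ?case
      by (simp add: bounded_clinear_add bounded_clinear_scaleC_left E_bounded_clinear simple_vimage[OF s])
  qed
  from this[OF simple_finite[OF s]] show ?thesis
    by (simp add: simple_spectral_integral_def[abs_def])
qed

lemma simple_int_mult:
  assumes "simple s" "simple s'"
  shows "simple_int (\<lambda>t. s t * s' t) f = simple_int s (simple_int s' f)"
proof -
  define p where "p = (\<lambda>t. (s t, s' t))"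
  have p: "simple p" unfolding p_def using assms by (rule simple_function_Pair)
  note v = simple_vimage[OF p]
  have "simple_int s (simple_int s' f) =
    (\<Sum>b\<in>range p. fst b *\<^sub>C E (p -` {b}) (\<Sum>b'\<in>range p. snd b' *\<^sub>C E (p -` {b'}) f))"
    using simple_int_comp[OF p, of fst "simple_int s' f"] simple_int_comp[OF p, of snd f]
    by (simp add: p_def)
  also have "\<dots> = (\<Sum>b\<in>range p. \<Sum>b'\<in>range p. (fst b * snd b') *\<^sub>C E (p -` {b} \<inter> p -` {b'}) f)"
    by (simp add: linear_sum[OF bounded_clinear_linear[OF E_bounded_clinear[OF v]]]
        bounded_clinear_scaleC[OF E_bounded_clinear[OF v]] E_Int[OF v v] scaleC.sum_right scaleC_scaleC)
  also have "\<dots> = (\<Sum>b\<in>range p. \<Sum>b'\<in>range p. if b' = b then (fst b * snd b) *\<^sub>C E (p -` {b}) f else 0)"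
  proof (intro sum.cong refl)
    fix b b'
    have "p -` {b} \<inter> p -` {b'} = {}" if "b' \<noteq> b" using that by auto
    then show "(fst b * snd b') *\<^sub>C E (p -` {b} \<inter> p -` {b'}) f =
        (if b' = b then (fst b * snd b) *\<^sub>C E (p -` {b}) f else 0)"
      by (cases "b' = b") (simp_all add: scaleC.zero_right)
  qed
  also have "\<dots> = (\<Sum>b\<in>range p. (fst b * snd b) *\<^sub>C E (p -` {b}) f)"
    using simple_finite[OF p] by (intro sum.cong refl) (simp add: sum.delta)
  also have "\<dots> = simple_int (\<lambda>t. s t * s' t) f"
    using simple_int_comp[OF p, of "\<lambda>b. fst b * snd b" f] by (simp add: p_def)
  finally show ?thesis ..
qed

lemma simple_int_cnj:
  assumes s: "simple s"
  shows "cinner g (simple_int s f) = cinner (simple_int (\<lambda>t. cnj (s t)) g) f"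
  using simple_int_comp[OF s, of cnj g]
  by (simp add: simple_spectral_integral_def cinner.sum_right cinner.sum_left cinner_scaleC_right
      cinner_scaleC_left E_selfadjoint[OF simple_vimage[OF s]])

lemma simple_int_indicator:
  assumes "A \<in> sets borel"
  shows "simple_int (indicator A) f = E A f"
proof -
  let ?s = "indicator A :: real \<Rightarrow> complex"
  have "simple_int ?s f = (\<Sum>c\<in>{0, 1}. c *\<^sub>C E (?s -` {c}) f)"
    unfolding simple_spectral_integral_def
  proof (rule sum.mono_neutral_left)
    show "range ?s \<subseteq> {0, 1}" by (auto simp: indicator_def)
    show "\<forall>c\<in>{0, 1} - range ?s. c *\<^sub>C E (?s -` {c}) f = 0"
    proof
      fix c assume "c \<in> {0, 1} - range ?s"
      then have "?s -` {c} = {}" by auto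
      then show "c *\<^sub>C E (?s -` {c}) f = 0" by (simp add: scaleC.zero_right)
    qed
  qed simp
  moreover have "?s -` {1} = A" by (auto simp: indicator_def)
  ultimately show ?thesis by (simp add: scaleC.zero_left)
qed

text \<open>The adjoint of \<open>\<integral> s dE\<close> is \<open>\<integral> cnj s dE\<close>, so \<open>\<parallel>\<integral> s dE f\<parallel>\<^sup>2 = (\<integral> |s|\<^sup>2 dE f, f)\<close>.\<close>

lemma norm_simple_int:
  assumes s: "simple s"
  shows "ennreal ((norm (simple_int s f))\<^sup>2) = (\<integral>\<^sup>+ t. ennreal ((cmod (s t))\<^sup>2) \<partial>\<mu> f)"
proof -
  note v = simple_vimage[OF s] and fin = simple_finite[OF s]
  have cs: "simple (\<lambda>t. cnj (s t))" using simple_function_compose1[OF s] .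
  have "complex_of_real ((norm (simple_int s f))\<^sup>2) =
      cinner (simple_int (\<lambda>t. cnj (s t)) (simple_int s f)) f"
    by (simp only: cinner_self[symmetric] simple_int_cnj[OF s])
  also have "\<dots> = cinner (simple_int (\<lambda>t. cnj (s t) * s t) f) f"
    by (simp only: simple_int_mult[OF cs s])
  also have "\<dots> = (\<Sum>c\<in>range s. complex_of_real ((cmod c)\<^sup>2 * (norm (E (s -` {c}) f))\<^sup>2))"
    unfolding simple_int_comp[OF s, of "\<lambda>c. cnj c * c" f]
    by (simp add: cinner.sum_left cinner_scaleC_left norm_E_sq[OF v] E_selfadjoint[OF v]
        complex_norm_square flip: of_real_power)
  finally have "(norm (simple_int s f))\<^sup>2 = (\<Sum>c\<in>range s. (cmod c)\<^sup>2 * (norm (E (s -` {c}) f))\<^sup>2)"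
    by (simp only: of_real_sum[symmetric] of_real_eq_iff)
  then have "ennreal ((norm (simple_int s f))\<^sup>2) =
      (\<Sum>c\<in>range s. ennreal ((cmod c)\<^sup>2) * emeasure (\<mu> f) (s -` {c}))"
    by (simp add: emeasure_spectral_measure[OF v] flip: ennreal_mult sum_ennreal)
  also have "\<dots> = (\<integral>\<^sup>+ t. (\<Sum>c\<in>range s. ennreal ((cmod c)\<^sup>2) * indicator (s -` {c}) t) \<partial>\<mu> f)"
    using v by (simp add: nn_integral_sum nn_integral_cmult_indicator)
  also have "\<dots> = (\<integral>\<^sup>+ t. ennreal ((cmod (s t))\<^sup>2) \<partial>\<mu> f)"
  proof (intro nn_integral_cong)
    fix t
    have "(\<Sum>c\<in>range s. ennreal ((cmod c)\<^sup>2) * indicator (s -` {c}) t) =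
      (\<Sum>c\<in>range s. if c = s t then ennreal ((cmod (s t))\<^sup>2) else 0)"
      by (intro sum.cong) (auto simp: indicator_def)
    then show "(\<Sum>c\<in>range s. ennreal ((cmod c)\<^sup>2) * indicator (s -` {c}) t) = ennreal ((cmod (s t))\<^sup>2)"
      using fin by (simp add: sum.delta)
  qed
  finally show ?thesis .
qed

end


section \<open>Spectral integrals of measurable functions\<close>

context spectral_resolution
begin

text \<open>The spectral integral as a total function, for use with integrands whose domain is known to contain
  the vector.\<close>

definition spec_int :: "(real \<Rightarrow> complex) \<Rightarrow> 'a \<Rightarrow> 'a" where
  "spec_int \<phi> f = app (spectral_integral E \<phi>) f"

abbreviation sq_norm :: "(real \<Rightarrow> complex) \<Rightarrow> 'a \<Rightarrow> ennreal" where
  "sq_norm \<phi> f \<equiv> \<integral>\<^sup>+ t. ennreal ((cmod (\<phi> t))\<^sup>2) \<partial>\<mu> f"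

lemma measurable_simple [measurable_dest]: "simple s \<Longrightarrow> s \<in> borel_measurable borel"
  for s :: "real \<Rightarrow> complex"
  by (rule borel_measurable_simple_function)

lemma sq_norm_const: "sq_norm (\<lambda>_. complex_of_real C) f = ennreal ((C * norm f)\<^sup>2)"
proof -
  have "sq_norm (\<lambda>_. complex_of_real C) f = ennreal (C\<^sup>2) * emeasure (\<mu> f) UNIV" by simp
  also have "emeasure (\<mu> f) UNIV = ennreal ((norm f)\<^sup>2)"
    by (subst emeasure_spectral_measure) (simp_all add: E_UNIV)
  finally show ?thesis by (simp add: power_mult_distrib ennreal_mult)
qed

lemma sq_norm_le_bound:
  assumes "\<And>t. cmod (\<phi> t) \<le> C"
  shows "sq_norm \<phi> f \<le> ennreal ((C * norm f)\<^sup>2)"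
  unfolding sq_norm_const[symmetric]
proof (intro nn_integral_mono ennreal_leI power_mono)
  show "cmod (\<phi> t) \<le> cmod (complex_of_real C)" for t
    using assms[of t] by simp
qed simp

lemma norm_simple_int_le:
  assumes "simple s" "\<And>t. cmod (s t) \<le> C" "C \<ge> 0"
  shows "norm (simple_int s f) \<le> C * norm f"
proof (rule power2_le_imp_le)
  have "ennreal ((norm (simple_int s f))\<^sup>2) \<le> ennreal ((C * norm f)\<^sup>2)"
    unfolding norm_simple_int[OF assms(1)] by (rule sq_norm_le_bound[OF assms(2)])
  then show "(norm (simple_int s f))\<^sup>2 \<le> (C * norm f)\<^sup>2" by simp
qed (use assms(3) in simp)

text \<open>The factor \<open>2\<close> costs nothing below: square integrability, boundedness and vanishing of \<open>\<phi>\<close> all pass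
  to the approximating functions.\<close>

lemma simple_approximation:
  assumes "\<phi> \<in> borel_measurable borel"
  obtains s :: "nat \<Rightarrow> real \<Rightarrow> complex" where "\<And>n. simple (s n)"
    "\<And>t. (\<lambda>n. s n t) \<longlonglongrightarrow> \<phi> t" "\<And>n t. cmod (s n t) \<le> 2 * cmod (\<phi> t)"
  using borel_measurable_implies_sequence_metric[OF assms, of 0] by auto

lemma sq_norm_diff_tendsto_0:
  assumes [measurable]: "\<And>n. \<phi>\<^sub>n n \<in> borel_measurable borel" "\<phi> \<in> borel_measurable borel"
      "\<gamma> \<in> borel_measurable borel"
    and lim: "\<And>t. (\<lambda>n. \<phi>\<^sub>n n t) \<longlonglongrightarrow> \<phi> t"
    and le: "\<And>n t. cmod (\<phi>\<^sub>n n t) \<le> cmod (\<gamma> t)" and fin: "sq_norm \<gamma> f < \<infinity>"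
  shows "(\<lambda>n. sq_norm (\<lambda>t. \<phi>\<^sub>n n t - \<phi> t) f) \<longlonglongrightarrow> 0"
proof -
  have le': "cmod (\<phi> t) \<le> cmod (\<gamma> t)" for t
    using le by (intro LIMSEQ_le_const2[OF tendsto_norm[OF lim]]) auto
  have "(\<lambda>n. sq_norm (\<lambda>t. \<phi>\<^sub>n n t - \<phi> t) f) \<longlonglongrightarrow> (\<integral>\<^sup>+ t. 0 \<partial>\<mu> f)"
  proof (rule nn_integral_dominated_convergence[where w = "\<lambda>t. 4 * ennreal ((cmod (\<gamma> t))\<^sup>2)"])
    show "(\<integral>\<^sup>+ t. 4 * ennreal ((cmod (\<gamma> t))\<^sup>2) \<partial>\<mu> f) < \<infinity>"
      using fin by (simp add: nn_integral_cmult ennreal_mult_less_top)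
    show "AE t in \<mu> f. ennreal ((cmod (\<phi>\<^sub>n n t - \<phi> t))\<^sup>2) \<le> 4 * ennreal ((cmod (\<gamma> t))\<^sup>2)" for n
    proof (rule AE_I2)
      fix t
      have "cmod (\<phi>\<^sub>n n t - \<phi> t) \<le> 2 * cmod (\<gamma> t)"
        using norm_triangle_ineq4[of "\<phi>\<^sub>n n t" "\<phi> t"] le[of n t] le'[of t] by linarith
      then have "(cmod (\<phi>\<^sub>n n t - \<phi> t))\<^sup>2 \<le> 4 * (cmod (\<gamma> t))\<^sup>2"
        using power_mono[of _ "2 * cmod (\<gamma> t)" 2] by (simp add: power_mult_distrib)
      then show "ennreal ((cmod (\<phi>\<^sub>n n t - \<phi> t))\<^sup>2) \<le> 4 * ennreal ((cmod (\<gamma> t))\<^sup>2)"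
        by (metis ennreal_leI ennreal_mult' ennreal_numeral zero_le_numeral)
    qed
    show "AE t in \<mu> f. (\<lambda>n. ennreal ((cmod (\<phi>\<^sub>n n t - \<phi> t))\<^sup>2)) \<longlonglongrightarrow> 0"
    proof (rule AE_I2)
      fix t
      have "(\<lambda>n. ennreal ((cmod (\<phi>\<^sub>n n t - \<phi> t))\<^sup>2)) \<longlonglongrightarrow> ennreal ((cmod (\<phi> t - \<phi> t))\<^sup>2)"
        by (intro tendsto_intros lim)
      then show "(\<lambda>n. ennreal ((cmod (\<phi>\<^sub>n n t - \<phi> t))\<^sup>2)) \<longlonglongrightarrow> 0" by simp
    qed
  qed simp_all
  then show ?thesis by simp
qed

text \<open>This and the next lemma use \<open>(a + b)\<^sup>2 \<le> 2 a\<^sup>2 + 2 b\<^sup>2\<close> in place of the triangle inequality, because the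
  squared norms are extended reals.\<close>

lemma sq_norm_diff_triangle:
  assumes [measurable]: "\<phi> \<in> borel_measurable borel" "\<eta> \<in> borel_measurable borel"
      "\<psi> \<in> borel_measurable borel"
  shows "sq_norm (\<lambda>t. \<phi> t - \<eta> t) f
    \<le> 2 * sq_norm (\<lambda>t. \<phi> t - \<psi> t) f + 2 * sq_norm (\<lambda>t. \<eta> t - \<psi> t) f"
proof -
  have "sq_norm (\<lambda>t. \<phi> t - \<eta> t) f \<le> (\<integral>\<^sup>+ t. 2 * ennreal ((cmod (\<phi> t - \<psi> t))\<^sup>2)
      + 2 * ennreal ((cmod (\<eta> t - \<psi> t))\<^sup>2) \<partial>\<mu> f)"
  proof (intro nn_integral_mono)
    fix t
    define a b where "a = cmod (\<phi> t - \<psi> t)" and "b = cmod (\<eta> t - \<psi> t)"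
    have "cmod (\<phi> t - \<eta> t) \<le> a + b"
      using norm_triangle_ineq4[of "\<phi> t - \<psi> t" "\<eta> t - \<psi> t"] by (simp add: a_def b_def)
    then have "(cmod (\<phi> t - \<eta> t))\<^sup>2 \<le> (a + b)\<^sup>2" by (intro power_mono) simp_all
    also have "\<dots> \<le> 2 * a\<^sup>2 + 2 * b\<^sup>2"
      using zero_le_power2[of "a - b"] by (simp add: power2_eq_square algebra_simps)
    finally have "ennreal ((cmod (\<phi> t - \<eta> t))\<^sup>2) \<le> ennreal (2 * a\<^sup>2 + 2 * b\<^sup>2)" by (rule ennreal_leI)
    then show "ennreal ((cmod (\<phi> t - \<eta> t))\<^sup>2) \<le> 2 * ennreal ((cmod (\<phi> t - \<psi> t))\<^sup>2)
        + 2 * ennreal ((cmod (\<eta> t - \<psi> t))\<^sup>2)"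
      by (simp add: ennreal_plus ennreal_mult' a_def b_def)
  qed
  also have "\<dots> = 2 * sq_norm (\<lambda>t. \<phi> t - \<psi> t) f + 2 * sq_norm (\<lambda>t. \<eta> t - \<psi> t) f"
    by (simp add: nn_integral_add nn_integral_cmult)
  finally show ?thesis .
qed

lemma simple_int_diff_le:
  assumes "simple s" "simple s'" "\<phi> \<in> borel_measurable borel"
  shows "ennreal ((norm (simple_int s f - simple_int s' f))\<^sup>2)
    \<le> 2 * sq_norm (\<lambda>t. s t - \<phi> t) f + 2 * sq_norm (\<lambda>t. s' t - \<phi> t) f"
proof -
  have d: "simple (\<lambda>t. s t - s' t)" using assms by (intro simple_function_diff)
  have "simple_int s f = simple_int (\<lambda>t. s t - s' t) f + simple_int s' f"
    using simple_int_add[OF d assms(2)] by simp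
  then have "ennreal ((norm (simple_int s f - simple_int s' f))\<^sup>2) = sq_norm (\<lambda>t. s t - s' t) f"
    using norm_simple_int[OF d, of f] by simp
  also have "\<dots> \<le> 2 * sq_norm (\<lambda>t. s t - \<phi> t) f + 2 * sq_norm (\<lambda>t. s' t - \<phi> t) f"
    by (rule sq_norm_diff_triangle[OF measurable_simple[OF assms(1)] measurable_simple[OF assms(2)] assms(3)])
  finally show ?thesis .
qed

text \<open>The isometry between simple functions in \<open>L\<^sup>2\<close> and their spectral integrals shows that the
  integrals of an \<open>L\<^sup>2\<close>-approximation converge, and that the limit does not depend on the
  approximation.\<close>

lemma spectral_integral_limit:
  assumes \<phi>: "\<phi> \<in> borel_measurable borel" and fin: "sq_norm \<phi> f < \<infinity>"
    and s: "\<And>n. simple (s n)" and lim: "(\<lambda>n. sq_norm (\<lambda>t. s n t - \<phi> t) f) \<longlonglongrightarrow> 0"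
  shows "(\<lambda>n. simple_int (s n) f) \<longlonglongrightarrow> spec_int \<phi> f"
    and "spectral_integral E \<phi> f = Some (spec_int \<phi> f)"
proof -
  have small: "\<forall>\<^sub>F n in sequentially. sq_norm (\<lambda>t. r n t - \<phi> t) f < ennreal (e\<^sup>2 / 4)"
    if "(\<lambda>n. sq_norm (\<lambda>t. r n t - \<phi> t) f) \<longlonglongrightarrow> 0" "e > 0" for r :: "nat \<Rightarrow> real \<Rightarrow> complex" and e
    using that by (intro order_tendstoD(2)[OF that(1)]) simp
  have close: "norm (simple_int r f - simple_int r' f) < e"
    if "simple r" "simple r'" "sq_norm (\<lambda>t. r t - \<phi> t) f < ennreal (e\<^sup>2 / 4)"
      "sq_norm (\<lambda>t. r' t - \<phi> t) f < ennreal (e\<^sup>2 / 4)" "e > 0" for r r' e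
  proof -
    have "ennreal ((norm (simple_int r f - simple_int r' f))\<^sup>2)
      \<le> 2 * sq_norm (\<lambda>t. r t - \<phi> t) f + 2 * sq_norm (\<lambda>t. r' t - \<phi> t) f"
      using that \<phi> by (intro simple_int_diff_le)
    also have "\<dots> < 2 * ennreal (e\<^sup>2 / 4) + 2 * ennreal (e\<^sup>2 / 4)"
      using that by (intro add_strict_mono ennreal_mult_strict_left_mono) auto
    also have "\<dots> = ennreal (e\<^sup>2)"
      by (simp flip: ennreal_plus ennreal_mult' ennreal_numeral)
    finally show ?thesis
      using that(5) by (simp add: ennreal_less_iff power_less_imp_less_base)
  qed
  have "Cauchy (\<lambda>n. simple_int (s n) f)"
  proof (rule metric_CauchyI)
    fix e :: real assume "e > 0"
    with small[OF lim] obtain N where "\<And>n. n \<ge> N \<Longrightarrow> sq_norm (\<lambda>t. s n t - \<phi> t) f < ennreal (e\<^sup>2 / 4)"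
      by (auto simp: eventually_sequentially)
    then show "\<exists>M. \<forall>m\<ge>M. \<forall>n\<ge>M. dist (simple_int (s m) f) (simple_int (s n) f) < e"
      using close[OF s s _ _ \<open>e > 0\<close>] unfolding dist_norm by blast
  qed
  then obtain h where h: "(\<lambda>n. simple_int (s n) f) \<longlonglongrightarrow> h"
    by (meson Cauchy_convergent_iff convergent_def)
  have unique: "h' = h" if r: "\<And>n. simple (r n)"
      "(\<lambda>n. sq_norm (\<lambda>t. r n t - \<phi> t) f) \<longlonglongrightarrow> 0" "(\<lambda>n. simple_int (r n) f) \<longlonglongrightarrow> h'" for r h'
  proof -
    have "(\<lambda>n. simple_int (r n) f - simple_int (s n) f) \<longlonglongrightarrow> 0"
      unfolding tendsto_iff
    proof (intro allI impI)
      fix e :: real assume e: "e > 0"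
      show "\<forall>\<^sub>F n in sequentially. dist (simple_int (r n) f - simple_int (s n) f) 0 < e"
        using small[OF r(2) e] small[OF lim e] unfolding dist_norm diff_0_right
        by eventually_elim (rule close[OF r(1) s _ _ e])
    qed
    from tendsto_add[OF this h] r(3) show ?thesis
      by (auto dest: LIMSEQ_unique)
  qed
  have "(THE h. \<exists>s. (\<forall>n::nat. simple (s n)) \<and> (\<lambda>n. sq_norm (\<lambda>t. s n t - \<phi> t) f) \<longlonglongrightarrow> 0
      \<and> (\<lambda>n. simple_int (s n) f) \<longlonglongrightarrow> h) = h"
    using s lim h unique by (intro the_equality) blast+
  then have "spectral_integral E \<phi> f = Some h"
    using fin by (simp add: spectral_integral_def)
  then show "(\<lambda>n. simple_int (s n) f) \<longlonglongrightarrow> spec_int \<phi> f"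
      "spectral_integral E \<phi> f = Some (spec_int \<phi> f)"
    using h by (simp_all add: spec_int_def app_def)
qed

lemma spec_int_tendsto:
  assumes \<phi>: "\<phi> \<in> borel_measurable borel" and \<gamma>: "\<gamma> \<in> borel_measurable borel" "sq_norm \<gamma> f < \<infinity>"
    and s: "\<And>n. simple (s n)" "\<And>t. (\<lambda>n. s n t) \<longlonglongrightarrow> \<phi> t" "\<And>n t. cmod (s n t) \<le> cmod (\<gamma> t)"
  shows "(\<lambda>n. simple_int (s n) f) \<longlonglongrightarrow> spec_int \<phi> f"
proof (rule spectral_integral_limit[OF \<phi> _ s(1)])
  have "cmod (\<phi> t) \<le> cmod (\<gamma> t)" for t
    using s(3) by (intro LIMSEQ_le_const2[OF tendsto_norm[OF s(2)]]) auto
  then have "sq_norm \<phi> f \<le> sq_norm \<gamma> f"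
    by (intro nn_integral_mono ennreal_leI power_mono) auto
  then show "sq_norm \<phi> f < \<infinity>" using \<gamma>(2) by (rule le_less_trans)
  show "(\<lambda>n. sq_norm (\<lambda>t. s n t - \<phi> t) f) \<longlonglongrightarrow> 0"
    using sq_norm_diff_tendsto_0[OF measurable_simple[OF s(1)] \<phi> \<gamma>(1) s(2,3) \<gamma>(2)] .
qed

lemma dom_spectral_integral: "f \<in> dom (spectral_integral E \<phi>) \<longleftrightarrow> sq_norm \<phi> f < \<infinity>"
  by (auto simp: spectral_integral_def dom_def)

lemma sq_norm_scaled:
  assumes "\<phi> \<in> borel_measurable borel" "sq_norm \<phi> f < \<infinity>"
  shows "sq_norm (\<lambda>t. 2 * \<phi> t) f < \<infinity>"
proof -
  have "ennreal ((cmod (2 * \<phi> t))\<^sup>2) = 4 * ennreal ((cmod (\<phi> t))\<^sup>2)" for t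
    by (simp add: norm_mult power_mult_distrib ennreal_mult')
  then show ?thesis
    using assms by (simp add: nn_integral_cmult ennreal_mult_less_top)
qed

lemma spectral_integral_eq_spec_int:
  assumes "\<phi> \<in> borel_measurable borel"
  shows "spectral_integral E \<phi> f = (if sq_norm \<phi> f < \<infinity> then Some (spec_int \<phi> f) else None)"
proof (cases "sq_norm \<phi> f < \<infinity>")
  case True
  then have "f \<in> dom (spectral_integral E \<phi>)" by (simp only: dom_spectral_integral)
  then show ?thesis using True by (auto simp: spec_int_def app_def)
next
  case False
  then show ?thesis by (simp add: spectral_integral_def)
qed


section \<open>The bounded functional calculus\<close>

definition bounded_borel :: "(real \<Rightarrow> complex) \<Rightarrow> bool" where
  "bounded_borel \<phi> \<longleftrightarrow> \<phi> \<in> borel_measurable borel \<and> (\<exists>C. \<forall>t. cmod (\<phi> t) \<le> C)"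

lemma bounded_borel_measurable [measurable_dest]: "bounded_borel \<phi> \<Longrightarrow> \<phi> \<in> borel_measurable borel"
  by (simp add: bounded_borel_def)

lemma bounded_borel_bound:
  assumes "bounded_borel \<phi>" obtains C where "C \<ge> 0" "\<And>t. cmod (\<phi> t) \<le> C"
  using assms norm_ge_zero order_trans unfolding bounded_borel_def by meson

lemma bounded_borelI: "\<phi> \<in> borel_measurable borel \<Longrightarrow> (\<And>t. cmod (\<phi> t) \<le> C) \<Longrightarrow> bounded_borel \<phi>"
  by (auto simp: bounded_borel_def)

lemma bounded_borel_const: "bounded_borel (\<lambda>_. c)"
  by (rule bounded_borelI[of _ "cmod c"]) simp_all

lemma bounded_borel_indicator: "A \<in> sets borel \<Longrightarrow> bounded_borel (indicator A)"
  by (rule bounded_borelI[of _ 1]) (auto simp: indicator_def)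

lemma bounded_borel_add:
  assumes "bounded_borel \<phi>" "bounded_borel \<psi>" shows "bounded_borel (\<lambda>t. \<phi> t + \<psi> t)"
proof -
  obtain C D where "\<And>t. cmod (\<phi> t) \<le> C" "\<And>t. cmod (\<psi> t) \<le> D"
    using assms bounded_borel_bound by metis
  then have "cmod (\<phi> t + \<psi> t) \<le> C + D" for t by (meson norm_triangle_mono)
  then show ?thesis using assms by (intro bounded_borelI[of _ "C + D"]) simp_all
qed

lemma bounded_borel_mult:
  assumes "bounded_borel \<phi>" "bounded_borel \<psi>" shows "bounded_borel (\<lambda>t. \<phi> t * \<psi> t)"
proof -
  obtain C D where "C \<ge> 0" "\<And>t. cmod (\<phi> t) \<le> C" "\<And>t. cmod (\<psi> t) \<le> D"
    using assms bounded_borel_bound by metis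
  then have "cmod (\<phi> t * \<psi> t) \<le> C * D" for t by (simp add: norm_mult mult_mono)
  then show ?thesis using assms by (intro bounded_borelI[of _ "C * D"]) simp_all
qed

lemma bounded_borel_cnj: "bounded_borel \<phi> \<Longrightarrow> bounded_borel (\<lambda>t. cnj (\<phi> t))"
  unfolding bounded_borel_def by (auto intro!: borel_measurable_continuous_on[of cnj] continuous_on_cnj continuous_on_id)

lemma bounded_borel_diff:
  "bounded_borel \<phi> \<Longrightarrow> bounded_borel \<psi> \<Longrightarrow> bounded_borel (\<lambda>t. \<phi> t - \<psi> t)"
  using bounded_borel_add[OF _ bounded_borel_mult[OF bounded_borel_const[of "-1"]], of \<phi> \<psi>] by simp

lemma bounded_borel_sq_norm: 
  assumes "bounded_borel \<phi>" shows "sq_norm \<phi> f < \<infinity>"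
  using bounded_borel_bound[OF assms] sq_norm_le_bound by (metis ennreal_less_top le_less_trans infinity_ennreal_def)

lemma spectral_integral_bounded:
  "bounded_borel \<phi> \<Longrightarrow> spectral_integral E \<phi> = (\<lambda>f. Some (spec_int \<phi> f))"
  by (rule ext) (simp add: spectral_integral_eq_spec_int bounded_borel_measurable bounded_borel_sq_norm
      del: infinity_ennreal_def)

lemma spec_int_tendsto_bounded:
  assumes s: "\<And>n. simple (s n)" "\<And>t. (\<lambda>n. s n t) \<longlonglongrightarrow> \<phi> t" "\<And>n t. cmod (s n t) \<le> C"
    and \<phi>: "\<phi> \<in> borel_measurable borel"
  shows "(\<lambda>n. simple_int (s n) f) \<longlonglongrightarrow> spec_int \<phi> f"
proof (rule spec_int_tendsto[OF \<phi>, of "\<lambda>_. complex_of_real C", OF _ _ s(1,2)])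
  show "sq_norm (\<lambda>_. complex_of_real C) f < \<infinity>" by (simp only: sq_norm_const) simp
  show "cmod (s n t) \<le> cmod (complex_of_real C)" for n t
    using s(3)[of n t] by simp
qed simp

text \<open>One sequence serves all vectors at once; for unbounded integrands the domain condition depends on the
  vector.\<close>

lemma bounded_simple_approximation:
  assumes \<phi>: "bounded_borel \<phi>"
  obtains s C where "\<And>n. simple (s n)" "\<And>t. (\<lambda>n. s n t) \<longlonglongrightarrow> \<phi> t" "\<And>n t. cmod (s n t) \<le> C"
    "C \<ge> 0" "\<And>f. (\<lambda>n. simple_int (s n) f) \<longlonglongrightarrow> spec_int \<phi> f"
proof -
  obtain C where C: "C \<ge> 0" "\<And>t. cmod (\<phi> t) \<le> C" using bounded_borel_bound[OF \<phi>] by metis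
  obtain s where s: "\<And>n. simple (s n)" "\<And>t. (\<lambda>n. s n t) \<longlonglongrightarrow> \<phi> t"
      "\<And>n t. cmod (s n t) \<le> 2 * cmod (\<phi> t)"
    using simple_approximation[OF bounded_borel_measurable[OF \<phi>]] by metis
  have "cmod (s n t) \<le> 2 * C" for n t using s(3)[of n t] C(2)[of t] by linarith
  then show thesis
    using s C by (intro that[of s "2 * C"] spec_int_tendsto_bounded[OF s(1,2) _ bounded_borel_measurable[OF \<phi>]]) auto
qed

lemma bounded_borel_simple:
  assumes s: "simple s"
  shows "bounded_borel s"
proof (rule bounded_borelI[OF measurable_simple[OF s]])
  show "cmod (s t) \<le> Max (cmod ` range s)" for t
    using simple_finite[OF s] by (intro Max_ge) auto
qed

lemma spec_int_simple:
  assumes s: "simple s"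
  shows "spec_int s f = simple_int s f"
proof -
  obtain C where "\<And>t. cmod (s t) \<le> C"
    using bounded_borel_bound[OF bounded_borel_simple[OF s]] by metis
  then have "(\<lambda>n. simple_int s f) \<longlonglongrightarrow> spec_int s f"
    using s by (intro spec_int_tendsto_bounded measurable_simple) auto
  then show ?thesis by (simp add: LIMSEQ_const_iff)
qed

lemma spec_int_indicator: "A \<in> sets borel \<Longrightarrow> spec_int (indicator A) f = E A f"
  by (simp add: spec_int_simple simple_int_indicator)

lemma spec_int_one: "spec_int (\<lambda>_. 1) f = f"
  using spec_int_indicator[of UNIV f] by (simp add: E_UNIV indicator_def)

lemma spec_int_const: "spec_int (\<lambda>_. c) f = c *\<^sub>C f"
proof -
  have "(\<lambda>_. c) -` {c} = (UNIV :: real set)" by auto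
  then have "simple_int (\<lambda>_. c) f = c *\<^sub>C f"
    by (simp add: simple_spectral_integral_def E_UNIV)
  then show ?thesis by (simp add: spec_int_simple)
qed

lemma spec_int_add:
  assumes "bounded_borel \<phi>" "bounded_borel \<psi>"
  shows "spec_int (\<lambda>t. \<phi> t + \<psi> t) f = spec_int \<phi> f + spec_int \<psi> f"
proof -
  obtain s C where s: "\<And>n. simple (s n)" "\<And>t. (\<lambda>n. s n t) \<longlonglongrightarrow> \<phi> t"
      "\<And>n t. cmod (s n t) \<le> C" "\<And>f. (\<lambda>n. simple_int (s n) f) \<longlonglongrightarrow> spec_int \<phi> f"
    using bounded_simple_approximation[OF assms(1)] by metis
  obtain r D where r: "\<And>n. simple (r n)" "\<And>t. (\<lambda>n. r n t) \<longlonglongrightarrow> \<psi> t"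
      "\<And>n t. cmod (r n t) \<le> D" "\<And>f. (\<lambda>n. simple_int (r n) f) \<longlonglongrightarrow> spec_int \<psi> f"
    using bounded_simple_approximation[OF assms(2)] by metis
  have "(\<lambda>n. simple_int (\<lambda>t. s n t + r n t) f) \<longlonglongrightarrow> spec_int (\<lambda>t. \<phi> t + \<psi> t) f"
  proof (rule spec_int_tendsto_bounded)
    show "cmod (s n t + r n t) \<le> C + D" for n t using s(3) r(3) by (meson norm_triangle_mono)
  qed (use s r assms in \<open>auto intro: tendsto_add simple_function_add bounded_borel_measurable bounded_borel_add\<close>)
  moreover have "(\<lambda>n. simple_int (\<lambda>t. s n t + r n t) f) \<longlonglongrightarrow> spec_int \<phi> f + spec_int \<psi> f"
    unfolding simple_int_add[OF s(1) r(1)] by (intro tendsto_add s r)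
  ultimately show ?thesis by (rule LIMSEQ_unique)
qed

lemma spec_int_bounded_clinear:
  assumes \<phi>: "bounded_borel \<phi>"
  shows "bounded_clinear (spec_int \<phi>)"
proof -
  obtain s C where s: "\<And>n. simple (s n)" "\<And>n t. cmod (s n t) \<le> C" "C \<ge> 0"
      "\<And>f. (\<lambda>n. simple_int (s n) f) \<longlonglongrightarrow> spec_int \<phi> f"
    using bounded_simple_approximation[OF \<phi>] by metis
  note lin = bounded_clinear_simps[OF simple_int_bounded_clinear[OF s(1)]]
  show ?thesis
  proof (rule bounded_clinearI)
    show "spec_int \<phi> (f + g) = spec_int \<phi> f + spec_int \<phi> g" for f g
      using s(4)[of "f + g"] tendsto_add[OF s(4)[of f] s(4)[of g]]
      by (simp add: lin) (rule LIMSEQ_unique)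
    show "spec_int \<phi> (c *\<^sub>C f) = c *\<^sub>C spec_int \<phi> f" for c f
      using s(4)[of "c *\<^sub>C f"] scaleC.tendsto[OF tendsto_const s(4)[of f], of c]
      by (simp add: lin) (rule LIMSEQ_unique)
    show "norm (spec_int \<phi> f) \<le> C * norm f" for f
      by (rule LIMSEQ_le_const2[OF tendsto_norm[OF s(4)]])
        (use norm_simple_int_le[OF s(1-3)] in blast)
  qed
qed

text \<open>Products of strongly convergent sequences converge strongly when the left factors are uniformly
  bounded.\<close>

lemma spec_int_mult:
  assumes "bounded_borel \<phi>" "bounded_borel \<psi>"
  shows "spec_int (\<lambda>t. \<phi> t * \<psi> t) f = spec_int \<phi> (spec_int \<psi> f)"
proof -
  obtain s C where s: "\<And>n. simple (s n)" "\<And>t. (\<lambda>n. s n t) \<longlonglongrightarrow> \<phi> t" "C \<ge> 0"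
      "\<And>n t. cmod (s n t) \<le> C" "\<And>f. (\<lambda>n. simple_int (s n) f) \<longlonglongrightarrow> spec_int \<phi> f"
    using bounded_simple_approximation[OF assms(1)] by metis
  obtain r D where r: "\<And>n. simple (r n)" "\<And>t. (\<lambda>n. r n t) \<longlonglongrightarrow> \<psi> t"
      "\<And>n t. cmod (r n t) \<le> D" "\<And>f. (\<lambda>n. simple_int (r n) f) \<longlonglongrightarrow> spec_int \<psi> f"
    using bounded_simple_approximation[OF assms(2)] by metis
  have "(\<lambda>n. simple_int (\<lambda>t. s n t * r n t) f) \<longlonglongrightarrow> spec_int (\<lambda>t. \<phi> t * \<psi> t) f"
  proof (rule spec_int_tendsto_bounded)
    show "cmod (s n t * r n t) \<le> C * D" for n t
      using s(3,4) r(3) by (simp add: norm_mult mult_mono)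
  qed (use s r assms in \<open>auto intro: tendsto_mult simple_function_mult bounded_borel_measurable bounded_borel_mult\<close>)
  moreover have "(\<lambda>n. simple_int (\<lambda>t. s n t * r n t) f) \<longlonglongrightarrow> spec_int \<phi> (spec_int \<psi> f)"
  proof -
    have bound: "norm (simple_int (s n) g) \<le> C * norm g" for n g
      using s(1,4,3) by (rule norm_simple_int_le)
    have "(\<lambda>n. simple_int (s n) (simple_int (r n) f - spec_int \<psi> f)) \<longlonglongrightarrow> 0"
    proof (rule Lim_null_comparison[OF always_eventually])
      show "\<forall>n. norm (simple_int (s n) (simple_int (r n) f - spec_int \<psi> f))
          \<le> C * norm (simple_int (r n) f - spec_int \<psi> f)"
        using bound by blast
      have "(\<lambda>n. C * norm (simple_int (r n) f - spec_int \<psi> f)) \<longlonglongrightarrow> C * norm (spec_int \<psi> f - spec_int \<psi> f)"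
        by (intro tendsto_intros r)
      then show "(\<lambda>n. C * norm (simple_int (r n) f - spec_int \<psi> f)) \<longlonglongrightarrow> 0" by simp
    qed
    from tendsto_add[OF this s(5)[of "spec_int \<psi> f"]] show ?thesis
      by (simp add: simple_int_mult[OF s(1) r(1)] bounded_clinear_simps[OF simple_int_bounded_clinear[OF s(1)]])
  qed
  ultimately show ?thesis by (rule LIMSEQ_unique)
qed

lemma spec_int_diff:
  assumes "bounded_borel \<phi>" "bounded_borel \<psi>"
  shows "spec_int (\<lambda>t. \<phi> t - \<psi> t) f = spec_int \<phi> f - spec_int \<psi> f"
  using spec_int_add[OF bounded_borel_diff[OF assms] assms(2), of f] by simp

lemma spec_int_scale: "bounded_borel \<phi> \<Longrightarrow> spec_int (\<lambda>t. c * \<phi> t) f = c *\<^sub>C spec_int \<phi> f"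
  by (simp add: spec_int_mult bounded_borel_const spec_int_const)

lemma spec_int_adjoint:
  assumes \<phi>: "bounded_borel \<phi>"
  shows "cinner g (spec_int \<phi> f) = cinner (spec_int (\<lambda>t. cnj (\<phi> t)) g) f"
proof -
  obtain s C where s: "\<And>n. simple (s n)" "\<And>t. (\<lambda>n. s n t) \<longlonglongrightarrow> \<phi> t"
      "\<And>n t. cmod (s n t) \<le> C" "\<And>f. (\<lambda>n. simple_int (s n) f) \<longlonglongrightarrow> spec_int \<phi> f"
    using bounded_simple_approximation[OF \<phi>] by metis
  have "(\<lambda>n. simple_int (\<lambda>t. cnj (s n t)) g) \<longlonglongrightarrow> spec_int (\<lambda>t. cnj (\<phi> t)) g"
    using s simple_function_compose1[OF s(1)]
    by (intro spec_int_tendsto_bounded[of _ _ C] bounded_borel_measurable bounded_borel_cnj[OF \<phi>])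
      (auto intro: tendsto_cnj)
  then have "(\<lambda>n. cinner (simple_int (\<lambda>t. cnj (s n t)) g) f) \<longlonglongrightarrow> cinner (spec_int (\<lambda>t. cnj (\<phi> t)) g) f"
    by (intro cinner.tendsto tendsto_const)
  moreover have "(\<lambda>n. cinner g (simple_int (s n) f)) \<longlonglongrightarrow> cinner g (spec_int \<phi> f)"
    by (intro cinner.tendsto tendsto_const s)
  ultimately show ?thesis
    by (simp add: simple_int_cnj[OF s(1)] LIMSEQ_unique)
qed

text \<open>The isometry passes from simple functions to bounded ones by dominated convergence on the right and
  strong convergence on the left.\<close>

lemma norm_spec_int:
  assumes \<phi>: "bounded_borel \<phi>"
  shows "ennreal ((norm (spec_int \<phi> f))\<^sup>2) = sq_norm \<phi> f"
proof -
  obtain s C where s: "\<And>n. simple (s n)" "\<And>t. (\<lambda>n. s n t) \<longlonglongrightarrow> \<phi> t"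
      "\<And>n t. cmod (s n t) \<le> C" "\<And>f. (\<lambda>n. simple_int (s n) f) \<longlonglongrightarrow> spec_int \<phi> f"
    using bounded_simple_approximation[OF \<phi>] by metis
  note [measurable] = s(1) \<phi>
  have "(\<lambda>n. sq_norm (s n) f) \<longlonglongrightarrow> sq_norm \<phi> f"
  proof (rule nn_integral_dominated_convergence[where w = "\<lambda>_. ennreal (C\<^sup>2)"])
    show "(\<integral>\<^sup>+ t. ennreal (C\<^sup>2) \<partial>\<mu> f) < \<infinity>"
      by (simp add: emeasure_spectral_measure ennreal_mult_less_top)
    show "AE t in \<mu> f. ennreal ((cmod (s n t))\<^sup>2) \<le> ennreal (C\<^sup>2)" for n
      by (intro AE_I2 ennreal_leI power_mono s) simp
    show "AE t in \<mu> f. (\<lambda>n. ennreal ((cmod (s n t))\<^sup>2)) \<longlonglongrightarrow> ennreal ((cmod (\<phi> t))\<^sup>2)"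
      by (intro AE_I2 tendsto_intros s)
  qed simp_all
  moreover have "(\<lambda>n. ennreal ((norm (simple_int (s n) f))\<^sup>2)) \<longlonglongrightarrow> ennreal ((norm (spec_int \<phi> f))\<^sup>2)"
    by (intro tendsto_intros s)
  ultimately show ?thesis
    unfolding norm_simple_int[OF s(1)] by (metis LIMSEQ_unique)
qed

lemma norm_spec_int_le:
  assumes "bounded_borel \<phi>" "\<And>t. cmod (\<phi> t) \<le> C" "C \<ge> 0"
  shows "norm (spec_int \<phi> f) \<le> C * norm f"
proof (rule power2_le_imp_le)
  have "ennreal ((norm (spec_int \<phi> f))\<^sup>2) \<le> ennreal ((C * norm f)\<^sup>2)"
    unfolding norm_spec_int[OF assms(1)] by (rule sq_norm_le_bound[OF assms(2)])
  then show "(norm (spec_int \<phi> f))\<^sup>2 \<le> (C * norm f)\<^sup>2" by simp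
qed (use assms(3) in simp)

text \<open>By the isometry this is dominated convergence in \<open>L\<^sup>2\<close> of the spectral measure of \<open>f\<close>.\<close>

lemma spec_int_dominated:
  assumes \<phi>: "\<And>n. bounded_borel (\<phi>\<^sub>n n)" "bounded_borel \<phi>"
    and lim: "\<And>t. (\<lambda>n. \<phi>\<^sub>n n t) \<longlonglongrightarrow> \<phi> t" and le: "\<And>n t. cmod (\<phi>\<^sub>n n t) \<le> C"
  shows "(\<lambda>n. spec_int (\<phi>\<^sub>n n) f) \<longlonglongrightarrow> spec_int \<phi> f"
proof -
  have "(\<lambda>n. sq_norm (\<lambda>t. \<phi>\<^sub>n n t - \<phi> t) f) \<longlonglongrightarrow> 0"
  proof (rule sq_norm_diff_tendsto_0[of _ _ "\<lambda>_. complex_of_real C", OF _ _ _ lim])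
    show "sq_norm (\<lambda>_. complex_of_real C) f < \<infinity>" by (simp only: sq_norm_const) simp
    show "cmod (\<phi>\<^sub>n n t) \<le> cmod (complex_of_real C)" for n t
      using le[of n t] by simp
  qed (use \<phi> in \<open>auto intro: bounded_borel_measurable\<close>)
  then have "(\<lambda>n. ennreal ((norm (spec_int (\<phi>\<^sub>n n) f - spec_int \<phi> f))\<^sup>2)) \<longlonglongrightarrow> ennreal 0"
    by (simp add: norm_spec_int[OF bounded_borel_diff, symmetric] \<phi> spec_int_diff)
  then have "(\<lambda>n. (norm (spec_int (\<phi>\<^sub>n n) f - spec_int \<phi> f))\<^sup>2) \<longlonglongrightarrow> 0"
    by (subst (asm) tendsto_ennreal_iff) auto
  then have "(\<lambda>n. norm (spec_int (\<phi>\<^sub>n n) f - spec_int \<phi> f)) \<longlonglongrightarrow> 0"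
    using tendsto_real_sqrt by fastforce
  then show ?thesis
    using LIM_zero_cancel tendsto_norm_zero_iff by blast
qed


section \<open>Unbounded spectral integrals on the range of the bounded calculus\<close>

text \<open>Fatou's lemma bounds \<open>\<parallel>\<phi>\<parallel>\<close> in \<open>L\<^sup>2\<close> of the spectral measure of \<open>spec_int \<psi> f\<close>: for simple
  \<open>s \<rightarrow> \<phi>\<close> with \<open>|s| \<le> 2 |\<phi>|\<close>, the products \<open>s \<psi>\<close> are uniformly bounded.\<close>

lemma spectral_integral_of_spec_int:
  assumes \<phi>: "\<phi> \<in> borel_measurable borel" and \<psi>: "bounded_borel \<psi>"
    and \<phi>\<psi>: "bounded_borel (\<lambda>t. \<phi> t * \<psi> t)"
  shows "spectral_integral E \<phi> (spec_int \<psi> f) = Some (spec_int (\<lambda>t. \<phi> t * \<psi> t) f)"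
proof -
  let ?g = "spec_int \<psi> f"
  obtain C where C: "C \<ge> 0" "\<And>t. cmod (\<phi> t * \<psi> t) \<le> C" using bounded_borel_bound[OF \<phi>\<psi>] by metis
  obtain s where s: "\<And>n. simple (s n)" "\<And>t. (\<lambda>n. s n t) \<longlonglongrightarrow> \<phi> t"
      "\<And>n t. cmod (s n t) \<le> 2 * cmod (\<phi> t)"
    using simple_approximation[OF \<phi>] by metis
  note [measurable] = s(1) \<phi>
  note s_bb = bounded_borel_simple[OF s(1)]
  have prod: "simple_int (s n) ?g = spec_int (\<lambda>t. s n t * \<psi> t) f" for n
    by (simp add: spec_int_mult s_bb \<psi> spec_int_simple[OF s(1)])
  have prod_le: "cmod (s n t * \<psi> t) \<le> 2 * C" for n t
    using mult_right_mono[OF s(3)[of n t], of "cmod (\<psi> t)"] C(2)[of t] by (simp add: norm_mult)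
  have "sq_norm \<phi> ?g = (\<integral>\<^sup>+ t. liminf (\<lambda>n. ennreal ((cmod (s n t))\<^sup>2)) \<partial>\<mu> ?g)"
    by (intro nn_integral_cong lim_imp_Liminf[symmetric] tendsto_intros s) simp
  also have "\<dots> \<le> liminf (\<lambda>n. sq_norm (s n) ?g)"
    by (rule nn_integral_liminf) simp
  also have "\<dots> \<le> liminf (\<lambda>n. ennreal ((2 * C * norm f)\<^sup>2))"
  proof (intro Liminf_mono always_eventually allI)
    fix n
    have "norm (simple_int (s n) ?g) \<le> 2 * C * norm f"
      unfolding prod using C by (intro norm_spec_int_le bounded_borel_mult s_bb \<psi> prod_le) simp
    then show "sq_norm (s n) ?g \<le> ennreal ((2 * C * norm f)\<^sup>2)"
      unfolding norm_simple_int[OF s(1), symmetric] by (intro ennreal_leI power_mono) auto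
  qed
  also have "\<dots> < \<infinity>" by (simp add: Liminf_const)
  finally have fin: "sq_norm \<phi> ?g < \<infinity>" .
  have "(\<lambda>n. simple_int (s n) ?g) \<longlonglongrightarrow> spec_int \<phi> ?g"
    using s(3) by (intro spec_int_tendsto[OF \<phi> _ sq_norm_scaled[OF \<phi> fin] s(1,2)]) (auto simp: norm_mult)
  moreover have "(\<lambda>n. simple_int (s n) ?g) \<longlonglongrightarrow> spec_int (\<lambda>t. \<phi> t * \<psi> t) f"
    unfolding prod
    by (intro spec_int_dominated[of _ _ "2 * C"] bounded_borel_mult s_bb \<psi> \<phi>\<psi> tendsto_mult s prod_le tendsto_const)
  ultimately have "spec_int \<phi> ?g = spec_int (\<lambda>t. \<phi> t * \<psi> t) f" by (rule LIMSEQ_unique)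
  then show ?thesis using fin by (simp add: spectral_integral_eq_spec_int[OF \<phi>])
qed

text \<open>The bounded operator \<open>spec_int \<psi>\<close> commutes with the limit that defines the unbounded integral.\<close>

lemma spec_int_of_spectral_integral:
  assumes \<phi>: "\<phi> \<in> borel_measurable borel" and \<psi>: "bounded_borel \<psi>"
    and \<psi>\<phi>: "bounded_borel (\<lambda>t. \<psi> t * \<phi> t)" and f: "spectral_integral E \<phi> f = Some h"
  shows "spec_int \<psi> h = spec_int (\<lambda>t. \<psi> t * \<phi> t) f"
proof -
  have fin: "sq_norm \<phi> f < \<infinity>" and h: "h = spec_int \<phi> f"
    using f by (auto simp: spectral_integral_eq_spec_int[OF \<phi>] split: if_splits)
  obtain C where C: "C \<ge> 0" "\<And>t. cmod (\<psi> t * \<phi> t) \<le> C" using bounded_borel_bound[OF \<psi>\<phi>] by metis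
  obtain s where s: "\<And>n. simple (s n)" "\<And>t. (\<lambda>n. s n t) \<longlonglongrightarrow> \<phi> t"
      "\<And>n t. cmod (s n t) \<le> 2 * cmod (\<phi> t)"
    using simple_approximation[OF \<phi>] by metis
  note s_bb = bounded_borel_simple[OF s(1)]
  have prod_le: "cmod (\<psi> t * s n t) \<le> 2 * C" for n t
    using mult_left_mono[OF s(3)[of n t], of "cmod (\<psi> t)"] C(2)[of t] by (simp add: norm_mult)
  have "(\<lambda>n. simple_int (s n) f) \<longlonglongrightarrow> h"
    unfolding h using s(3) \<phi> by (intro spec_int_tendsto[OF \<phi> _ sq_norm_scaled[OF \<phi> fin] s(1,2)]) (auto simp: norm_mult)
  then have "(\<lambda>n. spec_int \<psi> (simple_int (s n) f)) \<longlonglongrightarrow> spec_int \<psi> h"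
    by (rule bounded_linear.tendsto[OF bounded_clinear_bounded_linear[OF spec_int_bounded_clinear[OF \<psi>]]])
  moreover have "spec_int \<psi> (simple_int (s n) f) = spec_int (\<lambda>t. \<psi> t * s n t) f" for n
    by (simp add: spec_int_mult s_bb \<psi> spec_int_simple[OF s(1)])
  moreover have "(\<lambda>n. spec_int (\<lambda>t. \<psi> t * s n t) f) \<longlonglongrightarrow> spec_int (\<lambda>t. \<psi> t * \<phi> t) f"
    by (intro spec_int_dominated[of _ _ "2 * C"] bounded_borel_mult s_bb \<psi> \<psi>\<phi> tendsto_mult s prod_le tendsto_const)
  ultimately show ?thesis by (metis (no_types, lifting) LIMSEQ_unique ext)
qed

end


section \<open>The square root with cut along the positive half-line\<close>

lemma sqrt2pi_mult_self: "sqrt2pi z * sqrt2pi z = z"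
proof -
  have "sqrt2pi z * sqrt2pi z = complex_of_real (cmod z) * exp (\<i> * complex_of_real (Arg2pi z))"
    by (simp add: sqrt2pi_def mult_ac flip: of_real_mult exp_add)
  also have "\<dots> = z" using Arg2pi_eq[of z] by simp
  finally show ?thesis .
qed

lemma cmod_sqrt2pi: "cmod (sqrt2pi z) = sqrt (cmod z)"
  by (simp add: sqrt2pi_def norm_mult)

lemma sqrt2pi_eq_0_iff [simp]: "sqrt2pi z = 0 \<longleftrightarrow> z = 0"
  using sqrt2pi_mult_self[of z] by (auto simp: sqrt2pi_def)

text \<open>The only discontinuities of \<^const>\<open>Arg2pi\<close> lie on the closed positive half-line, where it is constant.\<close>

lemma borel_measurable_Arg2pi [measurable]: "Arg2pi \<in> borel_measurable borel"
proof -
  have "continuous_on (- \<real>\<^sub>\<ge>\<^sub>0) Arg2pi"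
    by (intro continuous_at_imp_continuous_on ballI continuous_at_Arg2pi) simp
  then have "(\<lambda>z. if z \<in> \<real>\<^sub>\<ge>\<^sub>0 then 0 else Arg2pi z) \<in> borel_measurable borel"
    by (intro borel_measurable_continuous_on_if borel_closed closed_nonneg_Reals_complex) simp_all
  also have "(\<lambda>z. if z \<in> \<real>\<^sub>\<ge>\<^sub>0 then 0 else Arg2pi z) = Arg2pi"
    by (auto simp: fun_eq_iff Arg2pi_eq_0 nonneg_Reals_def complex_is_Real_iff complex_nonneg_Reals_iff)
  finally show ?thesis .
qed

lemma borel_measurable_sqrt2pi [measurable]: "sqrt2pi \<in> borel_measurable borel"
  unfolding sqrt2pi_def by measurable


section \<open>The spectrum supports the spectral family\<close>

locale spectral_family_of = spectral_resolution E for E :: "real set \<Rightarrow> 'a::chilbert_space \<Rightarrow> 'a" +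
  fixes H0 :: "'a oper"
  assumes H0_eq: "H0 = spectral_integral E (\<lambda>t. complex_of_real t)"
begin

lemma E_full: "S \<in> sets borel \<Longrightarrow> E (- S) f = 0 \<Longrightarrow> E S f = f"
  using E_Un[of S "- S" f] by (simp add: E_UNIV)

text \<open>If \<open>z\<close> has positive distance from a set that carries \<open>E\<close>, then \<open>\<rho>(t) = 1 / (t - z)\<close> is bounded on that
  set, and both \<open>\<rho>\<close> and \<open>t \<rho>(t) = 1 + z \<rho>(t)\<close> belong to the bounded calculus.\<close>

lemma is_resolvent_at_support:
  assumes S: "S \<in> sets borel" and null: "\<And>f. E (- S) f = 0"
    and \<delta>: "\<delta> > 0" "\<And>t. t \<in> S \<Longrightarrow> \<delta> \<le> cmod (complex_of_real t - z)"
  defines "\<rho> \<equiv> \<lambda>t. indicator S t * inverse (complex_of_real t - z)"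
  shows "is_resolvent_at H0 z (spec_int \<rho>)" and "bounded_borel \<rho>"
proof -
  have "\<rho> \<in> borel_measurable borel" unfolding \<rho>_def using S by measurable
  moreover have "cmod (\<rho> t) \<le> inverse \<delta>" for t
    using \<delta> by (cases "t \<in> S") (auto simp: \<rho>_def norm_inverse intro: le_imp_inverse_le)
  ultimately show \<rho>: "bounded_borel \<rho>" by (rule bounded_borelI)
  have ind: "bounded_borel (indicator S)" using S by (rule bounded_borel_indicator)
  have t\<rho>: "(\<lambda>t. complex_of_real t * \<rho> t) = (\<lambda>t. indicator S t + z * \<rho> t)"
  proof
    fix t show "complex_of_real t * \<rho> t = indicator S t + z * \<rho> t"
    proof (cases "t \<in> S")
      case True
      then have "complex_of_real t - z \<noteq> 0" using \<delta>(2)[of t] \<delta>(1) by auto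
      then have "(complex_of_real t - z) * inverse (complex_of_real t - z) = 1" by simp
      then show ?thesis using True by (simp add: \<rho>_def algebra_simps)
    qed (simp add: \<rho>_def)
  qed
  have t\<rho>_bb: "bounded_borel (\<lambda>t. complex_of_real t * \<rho> t)"
    unfolding t\<rho> by (intro bounded_borel_add bounded_borel_mult bounded_borel_const ind \<rho>)
  have t\<rho>_int: "spec_int (\<lambda>t. complex_of_real t * \<rho> t) f = f + z *\<^sub>C spec_int \<rho> f" for f
    unfolding t\<rho> using S null
    by (simp add: spec_int_add spec_int_scale ind \<rho> bounded_borel_mult bounded_borel_const
        spec_int_indicator E_full)
  have "H0 f = Some (k + z *\<^sub>C f) \<longleftrightarrow> f = spec_int \<rho> k" for k f
  proof
    assume "f = spec_int \<rho> k"
    then show "H0 f = Some (k + z *\<^sub>C f)"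
      unfolding H0_eq using spectral_integral_of_spec_int[OF _ \<rho> t\<rho>_bb, of k] by (simp add: t\<rho>_int)
  next
    assume "H0 f = Some (k + z *\<^sub>C f)"
    then have "spec_int \<rho> (k + z *\<^sub>C f) = spec_int (\<lambda>t. \<rho> t * complex_of_real t) f"
      unfolding H0_eq by (intro spec_int_of_spectral_integral \<rho>) (use t\<rho>_bb in \<open>simp_all add: mult.commute\<close>)
    also have "\<dots> = f + z *\<^sub>C spec_int \<rho> f"
      using t\<rho>_int by (simp add: mult.commute)
    finally show "f = spec_int \<rho> k"
      by (simp add: bounded_clinear_simps[OF spec_int_bounded_clinear[OF \<rho>]])
  qed
  then show "is_resolvent_at H0 z (spec_int \<rho>)" by (simp add: is_resolvent_at_iff)
qed

text \<open>On the range of \<open>E (ball x \<epsilon>)\<close> the operator \<open>H0 - x\<close> has norm at most \<open>\<epsilon>\<close>, whereas its inverse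
  has norm at most \<open>K\<close>.  The range is therefore trivial as soon as \<open>K \<epsilon> < 1\<close>.\<close>

lemma E_null_near_real_resolvent_point:
  assumes "complex_of_real x \<in> resolvent_set H0"
  obtains \<epsilon> where "\<epsilon> > 0" "\<And>f. E (ball x \<epsilon>) f = 0"
proof -
  define R where "R = resolvent H0 (complex_of_real x)"
  have res: "is_resolvent_at H0 (complex_of_real x) R" and "bounded_clinear R"
    using assms by (simp_all add: resolvent_set_iff R_def)
  then obtain K where K: "K > 0" "\<And>f. norm (R f) \<le> K * norm f"
    using bounded_clinear_bound by metis
  define \<epsilon> where "\<epsilon> = 1 / (2 * K)"
  have \<epsilon>: "\<epsilon> > 0" using K by (simp add: \<epsilon>_def)
  define \<eta> where "\<eta> t = (complex_of_real t - complex_of_real x) * indicator (ball x \<epsilon>) t" for t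
  have \<eta>_le: "cmod (\<eta> t) \<le> \<epsilon>" for t
    using \<epsilon> by (cases "t \<in> ball x \<epsilon>")
      (simp_all add: \<eta>_def dist_real_def norm_mult abs_minus_commute flip: of_real_diff)
  have \<eta>: "bounded_borel \<eta>"
  proof (rule bounded_borelI[OF _ \<eta>_le])
    have [measurable]: "ball x \<epsilon> \<in> sets borel" by simp
    show "\<eta> \<in> borel_measurable borel" unfolding \<eta>_def[abs_def] by measurable
  qed
  have ind: "bounded_borel (indicator (ball x \<epsilon>))"
    by (rule bounded_borel_indicator) simp
  have t_eq: "(\<lambda>t. complex_of_real t * indicator (ball x \<epsilon>) t)
      = (\<lambda>t. \<eta> t + complex_of_real x * indicator (ball x \<epsilon>) t)"
    by (auto simp: \<eta>_def algebra_simps)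
  have "E (ball x \<epsilon>) f = 0" for f
  proof -
    define g where "g = E (ball x \<epsilon>) f"
    have g: "spec_int (indicator (ball x \<epsilon>)) g = g"
      by (simp add: spec_int_indicator g_def E_idem)
    have "bounded_borel (\<lambda>t. complex_of_real t * indicator (ball x \<epsilon>) t)"
      unfolding t_eq by (intro bounded_borel_add bounded_borel_mult bounded_borel_const ind \<eta>)
    from spectral_integral_of_spec_int[OF _ ind this, of g]
    have "H0 g = Some (spec_int \<eta> g + complex_of_real x *\<^sub>C g)"
      unfolding t_eq by (simp add: H0_eq g spec_int_add spec_int_scale \<eta> ind bounded_borel_mult bounded_borel_const)
    then have "g = R (spec_int \<eta> g)" using res by (simp add: is_resolvent_at_iff)
    then have "norm g \<le> K * norm (spec_int \<eta> g)" using K(2) by metis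
    also have "\<dots> \<le> K * (\<epsilon> * norm g)"
      using K \<epsilon> by (intro mult_left_mono norm_spec_int_le \<eta> \<eta>_le) simp_all
    also have "\<dots> = norm g / 2" using K by (simp add: \<epsilon>_def)
    finally show ?thesis by (simp add: g_def)
  qed
  then show thesis using that \<epsilon> by blast
qed

abbreviation real_spectrum :: "real set" ("\<sigma>") where
  "\<sigma> \<equiv> {t. complex_of_real t \<in> spectrum H0}"

text \<open>Each real point of the resolvent set has a ball on which \<open>E\<close> vanishes.  Such a ball again belongs to the
  resolvent set, because \<open>E\<close> is carried by its complement; hence the set is open.  Countably many of the
  balls cover it, so \<open>E\<close> vanishes on all of it.\<close>

lemma closed_real_spectrum: "closed \<sigma>" and E_off_spectrum: "E (- \<sigma>) f = 0"
proof -
  have off: "- \<sigma> = {x. complex_of_real x \<in> resolvent_set H0}" by (auto simp: spectrum_def)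
  have "\<forall>x\<in>- \<sigma>. \<exists>e>0. \<forall>f. E (ball x e) f = 0"
  proof
    fix x assume "x \<in> - \<sigma>"
    then have "complex_of_real x \<in> resolvent_set H0" unfolding off by simp
    then show "\<exists>e>0. \<forall>f. E (ball x e) f = 0"
      by (rule E_null_near_real_resolvent_point) blast
  qed
  then obtain r where "\<forall>x\<in>- \<sigma>. r x > 0 \<and> (\<forall>f. E (ball x (r x)) f = 0)"
    by (rule bchoice[THEN exE])
  then have r: "\<And>x. x \<in> - \<sigma> \<Longrightarrow> r x > 0" "\<And>x f. x \<in> - \<sigma> \<Longrightarrow> E (ball x (r x)) f = 0"
    by blast+
  have sub: "ball x (r x) \<subseteq> - \<sigma>" if x: "x \<in> - \<sigma>" for x
  proof
    fix t assume t: "t \<in> ball x (r x)"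
    have "r x - dist x t \<le> cmod (complex_of_real s - complex_of_real t)" if "s \<in> - ball x (r x)" for s
      using that dist_triangle[of x s t]
      by (simp add: dist_real_def dist_commute flip: of_real_diff)
    then have "is_resolvent_at H0 (complex_of_real t) (spec_int (\<lambda>s. indicator (- ball x (r x)) s *
        inverse (complex_of_real s - complex_of_real t)))"
      and "bounded_borel (\<lambda>s. indicator (- ball x (r x)) s * inverse (complex_of_real s - complex_of_real t))"
      using t r(2)[OF x]
      by (intro is_resolvent_at_support[where \<delta> = "r x - dist x t"]; simp)+
    then show "t \<in> - \<sigma>"
      unfolding off by (auto intro: resolvent_setI spec_int_bounded_clinear)
  qed
  have UN: "(\<Union>x\<in>- \<sigma>. ball x (r x)) = - \<sigma>"
  proof (intro equalityI subsetI)
    fix x assume "x \<in> - \<sigma>"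
    then show "x \<in> (\<Union>x\<in>- \<sigma>. ball x (r x))" using r(1) by (intro UN_I[of x]) auto
  qed (use sub in blast)
  have "open (\<Union>x\<in>- \<sigma>. ball x (r x))" by blast
  then show "closed \<sigma>" unfolding UN by (simp add: closed_def)
  obtain F where F: "F \<subseteq> (\<lambda>x. ball x (r x)) ` (- \<sigma>)" "countable F" "\<Union>F = \<Union>((\<lambda>x. ball x (r x)) ` (- \<sigma>))"
    by (rule Lindelof[of "(\<lambda>x. ball x (r x)) ` (- \<sigma>)"]) auto
  have "E (\<Union>B\<in>F. B) f = 0"
    using F(1,2) r(2) by (intro E_null_UN) auto
  then show "E (- \<sigma>) f = 0" using F(3) UN by simp
qed

lemma measurable_real_spectrum [measurable]: "\<sigma> \<in> sets borel"
  by (rule borel_closed[OF closed_real_spectrum])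

lemma spec_int_indicator_spectrum: "spec_int (indicator \<sigma>) f = f"
  by (simp only: spec_int_indicator[OF measurable_real_spectrum]
      E_full[OF measurable_real_spectrum E_off_spectrum])

lemma dist_spectrum_pos:
  assumes "z \<in> resolvent_set H0"
  obtains \<delta> where "\<delta> > 0" "\<And>t. t \<in> \<sigma> \<Longrightarrow> \<delta> \<le> cmod (complex_of_real t - z)"
proof (cases "Im z = 0")
  case True
  define x where "x = Re z"
  have z: "z = complex_of_real x" using True by (simp add: x_def complex_eq_iff)
  have "x \<in> - \<sigma>" using assms by (simp add: spectrum_def z)
  moreover have "open (- \<sigma>)" using closed_real_spectrum by (simp only: open_Compl)
  ultimately obtain e where e: "e > 0" "ball x e \<subseteq> - \<sigma>" by (metis open_contains_ball)
  have "e \<le> cmod (complex_of_real t - z)" if "t \<in> \<sigma>" for t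
  proof -
    have "t \<notin> ball x e" using e that by blast
    then show ?thesis by (simp add: z dist_real_def abs_minus_commute flip: of_real_diff)
  qed
  then show thesis using that e by blast
next
  case False
  have "\<bar>Im z\<bar> \<le> cmod (complex_of_real t - z)" for t
    using abs_Im_le_cmod[of "complex_of_real t - z"] by simp
  then show thesis using False that[of "\<bar>Im z\<bar>"] by simp
qed

text \<open>On \<open>[-m, -1/m]\<close> with \<open>m \<ge> 1\<close> write \<open>t = - (\<surd>(-t))\<^sup>2\<close>: nonnegativity of \<open>H0\<close> then forces the spectral integral
  of \<open>\<surd>(-t)\<close> to vanish there, and with it the spectral projection.\<close>

lemma E_negative_axis:
  assumes "nonneg_op H0"
  shows "E {..<0} f = 0"
proof -
  have null: "E {- real (Suc m)..- 1 / real (Suc m)} f = 0" for m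
  proof -
    define A where "A = {- real (Suc m)..- 1 / real (Suc m)}"
    have A: "A \<in> sets borel" by (simp add: A_def)
    have A_bounds: "1 / real (Suc m) \<le> - t" "- t \<le> real (Suc m)" if "t \<in> A" for t
      using that by (auto simp: A_def)
    have neg: "t < 0" if "t \<in> A" for t
      using A_bounds(1)[OF that] by (smt (verit) of_nat_0_less_iff zero_less_Suc zero_less_divide_1_iff)
    define \<eta> where "\<eta> t = indicator A t * complex_of_real (sqrt (- t))" for t
    define \<iota> where "\<iota> t = indicator A t * complex_of_real (1 / sqrt (- t))" for t
    have \<eta>: "bounded_borel \<eta>"
    proof (rule bounded_borelI)
      show "cmod (\<eta> t) \<le> sqrt (real (Suc m))" for t
        using A_bounds[of t] neg[of t]
        by (cases "t \<in> A") (simp_all add: \<eta>_def norm_mult del: of_nat_Suc)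
    qed (use A in \<open>unfold \<eta>_def[abs_def], measurable\<close>)
    have \<iota>: "bounded_borel \<iota>"
    proof (rule bounded_borelI)
      show "cmod (\<iota> t) \<le> sqrt (real (Suc m))" for t
      proof (cases "t \<in> A")
        case True
        have "1 / (- t) \<le> real (Suc m)"
          using A_bounds(1)[OF True] neg[OF True] by (simp add: field_simps del: of_nat_Suc)
        then have "sqrt (1 / (- t)) \<le> sqrt (real (Suc m))" by (rule real_sqrt_le_mono)
        then have "1 / sqrt (- t) \<le> sqrt (real (Suc m))"
          by (simp only: real_sqrt_divide real_sqrt_one)
        then show ?thesis
          using True neg[OF True] by (simp add: \<iota>_def norm_divide del: of_nat_Suc)
      qed (simp add: \<iota>_def)
    qed (use A in \<open>unfold \<iota>_def[abs_def], measurable\<close>)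
    have t_eq: "(\<lambda>t. complex_of_real t * indicator A t) = (\<lambda>t. (- 1) * (\<eta> t * \<eta> t))"
    proof
      fix t show "complex_of_real t * indicator A t = (- 1) * (\<eta> t * \<eta> t)"
      proof (cases "t \<in> A")
        case True
        then have "sqrt (- t) * sqrt (- t) = - t" using neg[OF True] by simp
        then show ?thesis using True by (simp add: \<eta>_def flip: of_real_mult)
      qed (simp add: \<eta>_def)
    qed
    have ind_eq: "(\<lambda>t. \<iota> t * \<eta> t) = indicator A"
      using neg by (auto simp: fun_eq_iff \<iota>_def \<eta>_def indicator_def)
    have cnj_\<eta>: "(\<lambda>t. cnj (\<eta> t)) = \<eta>"
      by (auto simp: fun_eq_iff \<eta>_def indicator_def)
    note [simp] = \<eta> \<iota> bounded_borel_mult bounded_borel_const bounded_borel_indicator[OF A]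
    define g where "g = E A f"
    have g: "spec_int (indicator A) g = g"
      using A by (simp add: spec_int_indicator g_def E_idem)
    have tA: "bounded_borel (\<lambda>t. complex_of_real t * indicator A t)"
      unfolding t_eq by (intro bounded_borel_mult bounded_borel_const \<eta>)
    have "H0 g = Some (spec_int (\<lambda>t. complex_of_real t * indicator A t) g)"
      using spectral_integral_of_spec_int[OF _ bounded_borel_indicator[OF A] tA, of g]
      by (simp add: H0_eq g)
    also have "spec_int (\<lambda>t. complex_of_real t * indicator A t) g = - spec_int \<eta> (spec_int \<eta> g)"
      unfolding t_eq by (subst spec_int_scale) (simp_all add: spec_int_mult)
    finally have H0_g: "H0 g = Some (- spec_int \<eta> (spec_int \<eta> g))" .
    then have "g \<in> dom H0" "app H0 g = - spec_int \<eta> (spec_int \<eta> g)"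
      by (simp_all add: dom_def app_def)
    then have "cinner g (- spec_int \<eta> (spec_int \<eta> g)) \<in> \<real>\<^sub>\<ge>\<^sub>0"
      using assms unfolding nonneg_op_def by metis
    moreover have "cinner g (- spec_int \<eta> (spec_int \<eta> g)) = - complex_of_real ((norm (spec_int \<eta> g))\<^sup>2)"
      using spec_int_adjoint[OF \<eta>, of g "spec_int \<eta> g"]
      by (simp only: cnj_\<eta> cinner.minus_right cinner_self)
    ultimately have "spec_int \<eta> g = 0"
      by (simp add: complex_nonneg_Reals_iff)
    then have "spec_int (\<lambda>t. \<iota> t * \<eta> t) g = 0"
      by (simp add: spec_int_mult bounded_clinear_simps[OF spec_int_bounded_clinear[OF \<iota>]])
    then show ?thesis unfolding ind_eq g by (simp only: g_def A_def)
  qed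
  have "{..<0} = (\<Union>m\<in>(UNIV :: nat set). {- real (Suc m)..- 1 / real (Suc m)})"
  proof (intro equalityI subsetI)
    fix t :: real assume "t \<in> {..<0}"
    then have t: "t < 0" by simp
    obtain m where m: "max (- t) (1 / (- t)) < real (Suc m)"
      using reals_Archimedean2 by (metis less_SucI of_nat_Suc less_trans lessI of_nat_less_iff)
    then have "1 < real (Suc m) * (- t)" using t by (simp add: field_simps del: of_nat_Suc)
    then have "1 / real (Suc m) < - t" by (simp add: divide_less_eq mult.commute del: of_nat_Suc)
    then show "t \<in> (\<Union>m\<in>(UNIV :: nat set). {- real (Suc m)..- 1 / real (Suc m)})"
      using m by (intro UN_I[of m]) auto
  next
    fix t assume "t \<in> (\<Union>m\<in>(UNIV :: nat set). {- real (Suc m)..- 1 / real (Suc m)})"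
    then obtain m where "t \<le> - (1 / real (Suc m))" by auto
    also have "\<dots> < 0" by simp
    finally show "t \<in> {..<0}" by simp
  qed
  then show ?thesis
    using E_null_UN[of "UNIV :: nat set" "\<lambda>m. {- real (Suc m)..- 1 / real (Suc m)}" f] null by simp
qed

lemma negative_in_resolvent_set:
  assumes "nonneg_op H0" "x < 0"
  shows "complex_of_real x \<in> resolvent_set H0"
proof -
  have "- x \<le> cmod (complex_of_real t - complex_of_real x)" if "t \<in> {0..}" for t
    using that assms(2) by (simp flip: of_real_diff)
  moreover have "- {0..} = {..<0::real}" by auto
  ultimately show ?thesis
    using is_resolvent_at_support[of "{0..}" "- x" "complex_of_real x"] E_negative_axis[OF assms(1)] assms(2)
    by (auto intro!: resolvent_setI spec_int_bounded_clinear)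
qed

end


section \<open>Inverse square roots of \<open>H0 - z\<close> and the scale of spaces\<close>

context spectral_family_of
begin

text \<open>The symbols of \<open>(H0 - z)\<^sup>1\<^sup>/\<^sup>2\<close>, of \<open>(H0 - z)\<^sup>-\<^sup>1\<^sup>/\<^sup>2\<close>, and of the quotient
  \<open>(H0 - w)\<^sup>1\<^sup>/\<^sup>2 (H0 - z)\<^sup>-\<^sup>1\<^sup>/\<^sup>2\<close>, which relates the points \<open>z\<close> and \<open>w\<close>.
  The last two are bounded for \<open>z\<close> in the resolvent set, thanks to the cutoff to the spectrum.\<close>

definition root_fun :: "complex \<Rightarrow> real \<Rightarrow> complex" where
  "root_fun z t = (if t \<in> \<sigma> then sqrt2pi (complex_of_real t - z) else 0)"

definition inv_root_fun :: "complex \<Rightarrow> real \<Rightarrow> complex" where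
  "inv_root_fun z t = (if t \<in> \<sigma> then inverse (sqrt2pi (complex_of_real t - z)) else 0)"

definition quot_fun :: "complex \<Rightarrow> complex \<Rightarrow> real \<Rightarrow> complex" where
  "quot_fun z w t = root_fun w t * inv_root_fun z t"

definition inv_root :: "complex \<Rightarrow> 'a \<Rightarrow> 'a" ("N") where
  "N z = spec_int (inv_root_fun z)"

definition root_quot :: "complex \<Rightarrow> complex \<Rightarrow> 'a \<Rightarrow> 'a" ("Q") where
  "Q z w = spec_int (quot_fun z w)"

lemma measurable_root_fun [measurable]: "root_fun z \<in> borel_measurable borel"
  and measurable_inv_root_fun [measurable]: "inv_root_fun z \<in> borel_measurable borel"
  unfolding root_fun_def[abs_def] inv_root_fun_def[abs_def] by measurable

lemma bounded_borel_inv_root_fun: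
  assumes "z \<in> resolvent_set H0" shows "bounded_borel (inv_root_fun z)"
proof -
  obtain \<delta> where \<delta>: "\<delta> > 0" "\<And>t. t \<in> \<sigma> \<Longrightarrow> \<delta> \<le> cmod (complex_of_real t - z)"
    using dist_spectrum_pos[OF assms] by metis
  have "cmod (inv_root_fun z t) \<le> inverse (sqrt \<delta>)" for t
    using \<delta> by (cases "t \<in> \<sigma>")
      (auto simp: inv_root_fun_def norm_inverse cmod_sqrt2pi intro!: le_imp_inverse_le)
  then show ?thesis by (intro bounded_borelI[of _ "inverse (sqrt \<delta>)"]) simp_all
qed

text \<open>This rests on \<open>|t - w| / |t - z| \<le> 1 + |z - w| / |t - z|\<close>.\<close>

lemma bounded_borel_quot_fun:
  assumes "z \<in> resolvent_set H0" shows "bounded_borel (quot_fun z w)"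
proof -
  obtain \<delta> where \<delta>: "\<delta> > 0" "\<And>t. t \<in> \<sigma> \<Longrightarrow> \<delta> \<le> cmod (complex_of_real t - z)"
    using dist_spectrum_pos[OF assms] by metis
  have "cmod (quot_fun z w t) \<le> sqrt (1 + cmod (z - w) / \<delta>)" for t
  proof (cases "t \<in> \<sigma>")
    case True
    define a where "a = cmod (complex_of_real t - z)"
    have a: "\<delta> \<le> a" using \<delta>(2)[OF True] by (simp add: a_def)
    then have "a > 0" using \<delta>(1) by linarith
    note a = a this
    have "cmod (complex_of_real t - w) \<le> a + cmod (z - w)"
      using norm_triangle_ineq[of "complex_of_real t - z" "z - w"] by (simp add: a_def)
    then have "cmod (complex_of_real t - w) / a \<le> (a + cmod (z - w)) / a"
      using a by (intro divide_right_mono) simp_all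
    also have "\<dots> = 1 + cmod (z - w) / a" using a by (simp add: add_divide_distrib)
    also have "\<dots> \<le> 1 + cmod (z - w) / \<delta>"
      using a \<delta>(1) by (intro add_left_mono divide_left_mono) simp_all
    finally have "sqrt (cmod (complex_of_real t - w) / a) \<le> sqrt (1 + cmod (z - w) / \<delta>)"
      by (rule real_sqrt_le_mono)
    moreover have "cmod (quot_fun z w t) = sqrt (cmod (complex_of_real t - w) / a)"
      using True
      by (simp add: quot_fun_def root_fun_def inv_root_fun_def norm_mult norm_inverse cmod_sqrt2pi
          real_sqrt_mult real_sqrt_inverse a_def divide_inverse)
    ultimately show ?thesis by simp
  next
    case False
    then show ?thesis using \<delta>(1) by (simp add: quot_fun_def root_fun_def)
  qed
  then show ?thesis unfolding quot_fun_def[abs_def] by (intro bounded_borelI) simp_all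
qed

lemma point_off_spectrum: "z \<in> resolvent_set H0 \<Longrightarrow> t \<in> \<sigma> \<Longrightarrow> complex_of_real t - z \<noteq> 0"
  by (auto simp: spectrum_def)

lemma
  assumes z: "z \<in> resolvent_set H0"
  shows root_inv_root_fun: "root_fun z t * inv_root_fun z t = indicator \<sigma> t"
    and inv_root_fun_square: "inv_root_fun z t * inv_root_fun z t
        = indicator \<sigma> t * inverse (complex_of_real t - z)"
  using point_off_spectrum[OF z, of t] sqrt2pi_mult_self[of "complex_of_real t - z"]
  by (cases "t \<in> \<sigma>"; simp add: root_fun_def inv_root_fun_def flip: inverse_mult_distrib)+

lemma root_fun_square: "root_fun z t * root_fun z t = indicator \<sigma> t * (complex_of_real t - z)"
  by (cases "t \<in> \<sigma>") (simp_all add: root_fun_def sqrt2pi_mult_self)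

lemma inv_root_fun_indicator: "inv_root_fun z t * indicator \<sigma> t = inv_root_fun z t"
  by (simp add: inv_root_fun_def)

lemma inv_root_fun_factor:
  assumes "w \<in> resolvent_set H0"
  shows "inv_root_fun z t = quot_fun z w t * inv_root_fun w t"
proof -
  have "quot_fun z w t * inv_root_fun w t = inv_root_fun z t * (root_fun w t * inv_root_fun w t)"
    by (simp add: quot_fun_def)
  then show ?thesis by (simp add: root_inv_root_fun[OF assms] inv_root_fun_indicator)
qed

lemma quot_fun_inverse:
  assumes "z \<in> resolvent_set H0" "w \<in> resolvent_set H0"
  shows "quot_fun w z t * quot_fun z w t = indicator \<sigma> t"
proof -
  have "quot_fun w z t * quot_fun z w t
      = (root_fun z t * inv_root_fun z t) * (root_fun w t * inv_root_fun w t)"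
    by (simp add: quot_fun_def)
  then show ?thesis using assms by (simp add: root_inv_root_fun indicator_def)
qed

text \<open>This is \<open>(t - w) / (t - z) = 1 + (z - w) / (t - z)\<close>.\<close>

lemma quot_fun_square:
  assumes "z \<in> resolvent_set H0"
  shows "quot_fun z w t * quot_fun z w t
    = indicator \<sigma> t + (z - w) * (inv_root_fun z t * inv_root_fun z t)"
proof -
  have "quot_fun z w t * quot_fun z w t
      = (root_fun w t * root_fun w t) * (inv_root_fun z t * inv_root_fun z t)"
    by (simp add: quot_fun_def)
  also have "\<dots> = indicator \<sigma> t * ((complex_of_real t - w) * inverse (complex_of_real t - z))"
    by (simp add: root_fun_square inv_root_fun_square[OF assms] indicator_def)
  also have "\<dots> = indicator \<sigma> t + (z - w) * (indicator \<sigma> t * inverse (complex_of_real t - z))"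
  proof (cases "t \<in> \<sigma>")
    case True
    then have "(complex_of_real t - z) * inverse (complex_of_real t - z) = 1"
      using point_off_spectrum[OF assms] by simp
    then show ?thesis using True by (simp add: algebra_simps)
  qed simp
  finally show ?thesis by (simp only: inv_root_fun_square[OF assms])
qed

lemma inv_root_bounded_clinear: "z \<in> resolvent_set H0 \<Longrightarrow> bounded_clinear (N z)"
  and root_quot_bounded_clinear: "z \<in> resolvent_set H0 \<Longrightarrow> bounded_clinear (Q z w)"
  by (simp_all add: inv_root_def root_quot_def spec_int_bounded_clinear bounded_borel_inv_root_fun
      bounded_borel_quot_fun)

lemma
  assumes z: "z \<in> resolvent_set H0" and w: "w \<in> resolvent_set H0"
  shows inv_root_eq_quot_left: "N z f = Q z w (N w f)"
    and inv_root_eq_quot_right: "N z f = N w (Q z w f)"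
    and root_quot_inverse: "Q w z (Q z w f) = f"
proof -
  note bb = bounded_borel_inv_root_fun[OF w] bounded_borel_quot_fun[OF z] bounded_borel_quot_fun[OF w]
  have eq: "inv_root_fun z = (\<lambda>t. quot_fun z w t * inv_root_fun w t)"
    by (rule ext) (rule inv_root_fun_factor[OF w])
  show "N z f = Q z w (N w f)" 
    unfolding inv_root_def root_quot_def by (subst eq) (simp add: spec_int_mult bb)
  have eq': "inv_root_fun z = (\<lambda>t. inv_root_fun w t * quot_fun z w t)"
    by (simp add: eq mult.commute)
  show "N z f = N w (Q z w f)"
    unfolding inv_root_def root_quot_def by (subst eq') (simp add: spec_int_mult bb)
  have "Q w z (Q z w f) = spec_int (\<lambda>t. quot_fun w z t * quot_fun z w t) f"
    unfolding root_quot_def by (simp add: spec_int_mult bb)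
  also have "\<dots> = f" using quot_fun_inverse[OF z w] spec_int_indicator_spectrum by simp
  finally show "Q w z (Q z w f) = f" .
qed

lemma root_quot_square:
  assumes z: "z \<in> resolvent_set H0"
  shows "Q z w (Q z w f) = f + (z - w) *\<^sub>C N z (N z f)"
proof -
  note bb = bounded_borel_inv_root_fun[OF z] bounded_borel_quot_fun[OF z]
    bounded_borel_indicator[OF measurable_real_spectrum] bounded_borel_mult bounded_borel_const
  have "Q z w (Q z w f) = spec_int (\<lambda>t. quot_fun z w t * quot_fun z w t) f"
    unfolding root_quot_def by (simp add: spec_int_mult bb)
  also have "\<dots> = spec_int (\<lambda>t. indicator \<sigma> t + (z - w) * (inv_root_fun z t * inv_root_fun z t)) f"
    by (simp only: quot_fun_square[OF z])
  also have "\<dots> = f + (z - w) *\<^sub>C N z (N z f)"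
    unfolding inv_root_def
    by (subst spec_int_add; (subst spec_int_scale)?) 
      (simp_all add: bb spec_int_mult spec_int_indicator_spectrum del: spec_int_indicator)
  finally show ?thesis .
qed

lemma resolvent_eq_inv_root_square:
  assumes z: "z \<in> resolvent_set H0"
  shows "resolvent H0 z f = N z (N z f)"
proof -
  obtain \<delta> where "\<delta> > 0" "\<And>t. t \<in> \<sigma> \<Longrightarrow> \<delta> \<le> cmod (complex_of_real t - z)"
    using dist_spectrum_pos[OF z] by metis
  from is_resolvent_at_support(1)[OF measurable_real_spectrum E_off_spectrum this]
  have "resolvent H0 z = spec_int (\<lambda>t. inv_root_fun z t * inv_root_fun z t)"
    unfolding inv_root_fun_square[OF z] by (rule is_resolvent_at_imp_resolvent)
  then show ?thesis
    by (simp add: inv_root_def spec_int_mult bounded_borel_inv_root_fun[OF z])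
qed

text \<open>The truncations of \<open>(H0 - z)\<^sup>1\<^sup>/\<^sup>2\<close> to the spectral subspaces of \<open>[-n, n]\<close> invert \<open>N z\<close> there, and
  these subspaces exhaust the space.\<close>

lemma truncated_root:
  assumes z: "z \<in> resolvent_set H0"
  obtains M where "\<And>f. M (N z f) = E {- real n..real n} f" "\<And>f. N z (M f) = E {- real n..real n} f"
    "M 0 = 0"
proof -
  define A where "A = {- real n..real n}"
  have A [measurable]: "A \<in> sets borel" by (simp add: A_def)
  define \<eta> where "\<eta> t = indicator A t * root_fun z t" for t
  have "cmod (\<eta> t) \<le> sqrt (real n + cmod z)" for t
  proof (cases "t \<in> A \<and> t \<in> \<sigma>")
    case True
    have "cmod (complex_of_real t - z) \<le> \<bar>t\<bar> + cmod z"
      using norm_triangle_ineq4[of "complex_of_real t" z] by simp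
    also have "\<dots> \<le> real n + cmod z" using True by (auto simp: A_def)
    finally show ?thesis using True by (simp add: \<eta>_def root_fun_def cmod_sqrt2pi)
  qed (auto simp: \<eta>_def root_fun_def)
  moreover have "\<eta> \<in> borel_measurable borel" unfolding \<eta>_def[abs_def] by measurable
  ultimately have \<eta>: "bounded_borel \<eta>" by (intro bounded_borelI)
  note bb = \<eta> bounded_borel_inv_root_fun[OF z] bounded_borel_indicator[OF A]
    bounded_borel_indicator[OF measurable_real_spectrum]
  have eq: "(\<lambda>t. \<eta> t * inv_root_fun z t) = (\<lambda>t. indicator A t * indicator \<sigma> t)"
    by (simp add: \<eta>_def root_inv_root_fun[OF z] mult.assoc)
  have E: "spec_int (\<lambda>t. indicator A t * indicator \<sigma> t) f = E A f" for f
    by (simp only: spec_int_mult bb spec_int_indicator_spectrum) (simp only: spec_int_indicator A)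
  show thesis
  proof (rule that[of "spec_int \<eta>"])
    show "spec_int \<eta> (N z f) = E {- real n..real n} f" for f
      unfolding inv_root_def using eq E[of f] by (simp add: A_def bb flip: spec_int_mult)
    have "(\<lambda>t. inv_root_fun z t * \<eta> t) = (\<lambda>t. \<eta> t * inv_root_fun z t)" by (simp add: mult.commute)
    then show "N z (spec_int \<eta> f) = E {- real n..real n} f" for f
      unfolding inv_root_def using eq E[of f] by (simp add: A_def bb flip: spec_int_mult)
    show "spec_int \<eta> 0 = 0" by (simp add: bounded_clinear_simps[OF spec_int_bounded_clinear[OF \<eta>]])
  qed
qed

lemma UN_centered_intervals: "(\<Union>n. {- real n..real n}) = UNIV"
proof -
  have "\<exists>n. \<bar>t\<bar> \<le> real n" for t by (rule real_arch_simple)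
  then have "\<exists>n. t \<in> {- real n..real n}" for t by (simp add: abs_le_iff minus_le_iff conj_commute)
  then show ?thesis by blast
qed

lemma inv_root_eq_0_iff:
  assumes z: "z \<in> resolvent_set H0"
  shows "N z f = 0 \<longleftrightarrow> f = 0"
proof
  assume "N z f = 0"
  then have "E {- real n..real n} f = 0" for n
    by (metis truncated_root[OF z, of n])
  then have "E (\<Union>n\<in>UNIV. {- real n..real n}) f = 0"
    by (intro E_null_UN) simp_all
  then show "f = 0" by (simp add: UN_centered_intervals E_UNIV)
qed (simp add: bounded_clinear_simps[OF inv_root_bounded_clinear[OF z]])

lemma closure_range_inv_root:
  assumes z: "z \<in> resolvent_set H0"
  shows "closure (range (N z)) = UNIV"
proof -
  have "f \<in> closure (range (N z))" for f
    unfolding closure_sequential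
  proof (intro exI conjI allI)
    show "E {- real n..real n} f \<in> range (N z)" for n
      by (metis truncated_root[OF z, of n] rangeI)
    have "(\<lambda>n. spec_int (indicator {- real n..real n}) f) \<longlonglongrightarrow> spec_int (\<lambda>_. 1) f"
    proof (rule spec_int_dominated[where C = 1])
      fix t
      obtain m where m: "\<bar>t\<bar> \<le> real m" using real_arch_simple by blast
      have "indicator {- real n..real n} t = (1 :: complex)" if "n \<ge> m" for n
      proof -
        have "real m \<le> real n" using that by simp
        then show ?thesis using m by (auto simp: indicator_def)
      qed
      then show "(\<lambda>n. indicator {- real n..real n} t) \<longlonglongrightarrow> (1 :: complex)"
        by (intro tendsto_eventually) (auto simp: eventually_sequentially)
    qed (auto simp: bounded_borel_indicator bounded_borel_const indicator_def)
    then show "(\<lambda>n. E {- real n..real n} f) \<longlonglongrightarrow> f"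
      by (simp add: spec_int_indicator spec_int_one)
  qed
  then show ?thesis by blast
qed

lemma neg_half_power_eq: "neg_half_power E H0 z = spectral_integral E (inv_root_fun z)"
  and half_power_eq: "half_power E H0 z = spectral_integral E (root_fun z)"
  by (simp_all add: neg_half_power_def half_power_def spectral_integral_on_def inv_root_fun_def[abs_def]
      root_fun_def[abs_def])

lemma neg_half_power_Some: "z \<in> resolvent_set H0 \<Longrightarrow> neg_half_power E H0 z = (\<lambda>f. Some (N z f))"
  by (simp add: neg_half_power_eq spectral_integral_bounded bounded_borel_inv_root_fun inv_root_def)

lemma app_neg_half_power: "z \<in> resolvent_set H0 \<Longrightarrow> app (neg_half_power E H0 z) f = N z f"
  by (simp add: neg_half_power_Some app_def)

definition inv_root_adj :: "complex \<Rightarrow> 'a \<Rightarrow> 'a" ("N*") where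
  "N* z = spec_int (\<lambda>t. cnj (inv_root_fun z t))"

lemma app_adjoint_neg_half_power:
  assumes z: "z \<in> resolvent_set H0"
  shows "app (adjoint_op (neg_half_power E H0 z)) g = N* z g"
proof -
  have adj: "cinner g (N z f) = cinner (N* z g) f" for f
    unfolding inv_root_def inv_root_adj_def
    by (rule spec_int_adjoint[OF bounded_borel_inv_root_fun[OF z]])
  have "(THE h. \<forall>f. cinner g (N z f) = cinner h f) = N* z g"
  proof (rule the_equality)
    fix h assume "\<forall>f. cinner g (N z f) = cinner h f"
    then have "cinner f h = cinner f (N* z g)" for f
      by (metis adj cinner_commute)
    then show "h = N* z g" by (rule cinner_eqI)
  qed (simp add: adj)
  moreover have "\<exists>h. \<forall>f. cinner g (N z f) = cinner h f" using adj by blast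
  ultimately show ?thesis
    by (simp add: adjoint_op_def neg_half_power_Some[OF z] app_def dom_def)
qed

lemma bounded_borel_root_mult:
  assumes "z \<in> resolvent_set H0"
  shows "bounded_borel (\<lambda>t. root_fun 0 t * inv_root_fun z t)"
    and "bounded_borel (\<lambda>t. root_fun 0 t * cnj (inv_root_fun z t))"
proof -
  show bb: "bounded_borel (\<lambda>t. root_fun 0 t * inv_root_fun z t)"
    using bounded_borel_quot_fun[OF assms, of 0] by (simp add: quot_fun_def[abs_def])
  then obtain C where C: "\<And>t. cmod (root_fun 0 t * inv_root_fun z t) \<le> C"
    using bounded_borel_bound by metis
  show "bounded_borel (\<lambda>t. root_fun 0 t * cnj (inv_root_fun z t))"
  proof (rule bounded_borelI)
    show "(\<lambda>t. root_fun 0 t * cnj (inv_root_fun z t)) \<in> borel_measurable borel"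
      by (intro borel_measurable_times measurable_root_fun bounded_borel_measurable bounded_borel_cnj
          bounded_borel_inv_root_fun assms)
    show "cmod (root_fun 0 t * cnj (inv_root_fun z t)) \<le> C" for t
      using C[of t] by (simp add: norm_mult)
  qed
qed

text \<open>Vectors in the range of the bounded calculus lie in \<open>\<H>\<^sub>+\<^sub>1\<close> when the symbol absorbs the square root of
  \<open>t\<close>.  This is needed both for \<open>(H0 - z)\<^sup>-\<^sup>1\<^sup>/\<^sup>2\<close> and for its adjoint, whose symbol is the conjugate.\<close>

lemma spec_int_in_H_plus:
  assumes \<psi>: "bounded_borel \<psi>" and root: "bounded_borel (\<lambda>t. root_fun 0 t * \<psi> t)"
  shows "spec_int \<psi> f \<in> H_plus E H0"
    and "\<exists>K. \<forall>f. norm_plus E H0 (spec_int \<psi> f) \<le> K * norm f"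
proof -
  have half: "half_power E H0 0 (spec_int \<psi> f) = Some (spec_int (\<lambda>t. root_fun 0 t * \<psi> t) f)" for f
    unfolding half_power_eq by (rule spectral_integral_of_spec_int[OF measurable_root_fun \<psi> root])
  then show "spec_int \<psi> f \<in> H_plus E H0" by (auto simp: H_plus_def)
  obtain C where C: "\<And>f. norm (spec_int \<psi> f) \<le> C * norm f"
    using bounded_clinear_bound[OF spec_int_bounded_clinear[OF \<psi>]] by metis
  obtain D where D: "\<And>f. norm (spec_int (\<lambda>t. root_fun 0 t * \<psi> t) f) \<le> D * norm f"
    using bounded_clinear_bound[OF spec_int_bounded_clinear[OF root]] by metis
  have "norm_plus E H0 (spec_int \<psi> f) \<le> (D + C) * norm f" for f
  proof -
    have "norm_plus E H0 (spec_int \<psi> f)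
        = sqrt ((norm (spec_int (\<lambda>t. root_fun 0 t * \<psi> t) f))\<^sup>2 + (norm (spec_int \<psi> f))\<^sup>2)"
      by (simp add: norm_plus_def cinner_plus_def app_def half cinner_self)
    also have "\<dots> \<le> norm (spec_int (\<lambda>t. root_fun 0 t * \<psi> t) f) + norm (spec_int \<psi> f)"
      by (rule sqrt_sum_squares_le_sum) simp_all
    also have "\<dots> \<le> (D + C) * norm f" using C[of f] D[of f] by (simp add: distrib_right)
    finally show ?thesis .
  qed
  then show "\<exists>K. \<forall>f. norm_plus E H0 (spec_int \<psi> f) \<le> K * norm f" by blast
qed

lemma inv_root_in_H_plus: "z \<in> resolvent_set H0 \<Longrightarrow> N z f \<in> H_plus E H0"
  unfolding inv_root_def
  by (intro spec_int_in_H_plus(1) bounded_borel_inv_root_fun bounded_borel_root_mult(1))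

text \<open>The right-hand side is a bounded conjugate linear functional of \<open>g\<close>, because the adjoint maps
  boundedly into \<open>\<H>\<^sub>+\<^sub>1\<close>.  The representing vector therefore exists.\<close>

lemma neg_half_power_ext:
  assumes z: "z \<in> resolvent_set H0" and \<Psi>: "\<Psi> \<in> H_minus E H0"
  shows "cinner g (neg_half_power_ext E H0 z \<Psi>) = \<Psi> (N* z g)"
proof -
  note bb = bounded_borel_cnj[OF bounded_borel_inv_root_fun[OF z]]
  note lin = bounded_clinear_simps[OF spec_int_bounded_clinear[OF bb], folded inv_root_adj_def]
  note plus = spec_int_in_H_plus[OF bb bounded_borel_root_mult(2)[OF z], folded inv_root_adj_def]
  obtain L where L: "\<And>g. norm_plus E H0 (N* z g) \<le> L * norm g" using plus(2) by blast
  obtain K where K: "\<And>g. g \<in> H_plus E H0 \<Longrightarrow> cmod (\<Psi> g) \<le> K * norm_plus E H0 g"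
    using \<Psi> unfolding H_minus_def by blast
  obtain f where f: "\<And>g. cinner g f = \<Psi> (N* z g)"
  proof (rule Riesz_conjugate_linear[of "\<lambda>g. \<Psi> (N* z g)" "\<bar>K\<bar> * L"])
    show "\<Psi> (N* z (x + y)) = \<Psi> (N* z x) + \<Psi> (N* z y)" for x y
      using \<Psi> plus(1) by (simp add: lin H_minus_def)
    show "\<Psi> (N* z (c *\<^sub>C x)) = cnj c * \<Psi> (N* z x)" for c x
      using \<Psi> plus(1) by (simp add: lin H_minus_def)
    show "cmod (\<Psi> (N* z x)) \<le> \<bar>K\<bar> * L * norm x" for x
    proof -
      have pos: "0 \<le> norm_plus E H0 (N* z x)"
        by (simp add: norm_plus_def cinner_plus_def Re_cinner)
      have "cmod (\<Psi> (N* z x)) \<le> K * norm_plus E H0 (N* z x)" by (rule K[OF plus(1)])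
      also have "\<dots> \<le> \<bar>K\<bar> * norm_plus E H0 (N* z x)" using pos by (intro mult_right_mono) simp_all
      also have "\<dots> \<le> \<bar>K\<bar> * (L * norm x)" by (intro mult_left_mono L) simp
      finally show ?thesis by simp
    qed
  qed blast
  have "neg_half_power_ext E H0 z \<Psi> = f"
    unfolding neg_half_power_ext_def app_adjoint_neg_half_power[OF z]
  proof (rule the_equality)
    fix f' assume "\<forall>g. cinner g f' = \<Psi> (N* z g)"
    then show "f' = f" using f by (intro cinner_eqI) simp
  qed (simp add: f)
  then show ?thesis by (simp add: f)
qed

text \<open>By duality this is the factorization of the adjoint of \<open>N z\<close> as the adjoint of \<open>N w\<close> after the adjoint
  of \<open>Q z w\<close>.\<close>

lemma neg_half_power_ext_quot:
  assumes z: "z \<in> resolvent_set H0" and w: "w \<in> resolvent_set H0" and \<Psi>: "\<Psi> \<in> H_minus E H0"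
  shows "neg_half_power_ext E H0 z \<Psi> = Q z w (neg_half_power_ext E H0 w \<Psi>)"
proof (rule cinner_eqI)
  fix g
  note bb = bounded_borel_cnj[OF bounded_borel_inv_root_fun[OF w]]
    bounded_borel_cnj[OF bounded_borel_quot_fun[OF z, of w]]
  have "N* z g = spec_int (\<lambda>t. cnj (inv_root_fun w t) * cnj (quot_fun z w t)) g"
    unfolding inv_root_adj_def by (subst inv_root_fun_factor[OF w]) (simp add: mult.commute)
  also have "\<dots> = N* w (spec_int (\<lambda>t. cnj (quot_fun z w t)) g)"
    unfolding inv_root_adj_def by (rule spec_int_mult[OF bb])
  finally have "cinner g (neg_half_power_ext E H0 z \<Psi>)
      = cinner (spec_int (\<lambda>t. cnj (quot_fun z w t)) g) (neg_half_power_ext E H0 w \<Psi>)"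
    by (simp add: neg_half_power_ext[OF z \<Psi>] neg_half_power_ext[OF w \<Psi>])
  also have "\<dots> = cinner g (Q z w (neg_half_power_ext E H0 w \<Psi>))"
    unfolding root_quot_def by (rule spec_int_adjoint[OF bounded_borel_quot_fun[OF z], symmetric])
  finally show "cinner g (neg_half_power_ext E H0 z \<Psi>) = cinner g (Q z w (neg_half_power_ext E H0 w \<Psi>))" .
qed

end


section \<open>The perturbed operator\<close>

locale form_perturbation = spectral_family_of E H0
  for E :: "real set \<Rightarrow> 'a::chilbert_space \<Rightarrow> 'a" and H0 :: "'a oper" +
  fixes V :: "'a \<Rightarrow> 'a \<Rightarrow> complex"
  assumes V: "bounded_linear_plus_minus E H0 V"
begin

abbreviation "A \<equiv> A_op E H0 V"

text \<open>Both outer factors of \<open>A z\<close> contribute the same bounded quotient of square roots, so that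
  \<open>A z\<close> and \<open>A w\<close> determine each other through bounded operators.\<close>

lemma A_op_change_point:
  assumes z: "z \<in> resolvent_set H0" and w: "w \<in> resolvent_set H0"
  shows "A z f = Q z w (A w (Q z w f))"
proof -
  have "V (N z f) \<in> H_minus E H0"
    using V inv_root_in_H_plus[OF z] by (simp add: bounded_linear_plus_minus_def)
  then have "neg_half_power_ext E H0 z (V (N z f))
      = Q z w (neg_half_power_ext E H0 w (V (N w (Q z w f))))"
    unfolding inv_root_eq_quot_right[OF z w, symmetric] by (rule neg_half_power_ext_quot[OF z w])
  then show ?thesis
    by (simp add: A_op_def app_neg_half_power z w
        bounded_clinear_simps[OF root_quot_bounded_clinear[OF z]])
qed

lemma compact_A_op:
  assumes "z \<in> resolvent_set H0" "w \<in> resolvent_set H0" "compact_op (A w)"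
  shows "compact_op (A z)"
  using compact_op_compose[OF assms(3) root_quot_bounded_clinear[OF assms(1)]
      root_quot_bounded_clinear[OF assms(1)], of w w]
  by (simp add: A_op_change_point[OF assms(1,2), symmetric])

text \<open>The equation \<open>f = R(z) (h - z f)\<close>, written with the preimage \<open>u\<close> of \<open>f\<close> under \<open>N z\<close>.  It states
  \<open>H0 f + V f = h\<close> in \<open>\<H>\<^sub>-\<^sub>1\<close>, with \<open>(H0 - z)\<^sup>-\<^sup>1\<^sup>/\<^sup>2\<close> applied to it, whence it does not depend on \<open>z\<close>.\<close>

definition graph_at :: "complex \<Rightarrow> 'a \<Rightarrow> 'a \<Rightarrow> bool" where
  "graph_at z f h \<longleftrightarrow> (\<exists>u. f = N z u \<and> u - A z u = N z (h - z *\<^sub>C f))"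

text \<open>If \<open>u\<close> solves the equation at \<open>z\<close>, then \<open>Q z w u\<close> solves it at \<open>w\<close>: apply \<open>Q w z\<close> to the equation at \<open>z\<close>
  and use \<open>(Q w z)\<^sup>2 = I + (w - z) (N w)\<^sup>2\<close>.\<close>

lemma graph_at_change_point:
  assumes z: "z \<in> resolvent_set H0" and w: "w \<in> resolvent_set H0"
    and "graph_at z f h"
  shows "graph_at w f h"
proof -
  obtain u where u: "f = N z u" "u - A z u = N z (h - z *\<^sub>C f)"
    using assms(3) by (auto simp: graph_at_def)
  define u' where "u' = Q z w u"
  note Q_lin = bounded_clinear_simps[OF root_quot_bounded_clinear[OF w]]
    and N_lin = bounded_clinear_simps[OF inv_root_bounded_clinear[OF w]]
  have f: "f = N w u'" by (simp add: u(1) u'_def inv_root_eq_quot_right[OF z w])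
  have "Q w z (u - A z u) = N w (h - z *\<^sub>C f)"
    unfolding u(2) by (rule inv_root_eq_quot_left[OF w z, symmetric])
  moreover have "Q w z (A z u) = A w u'"
    unfolding A_op_change_point[OF z w] u'_def by (rule root_quot_inverse[OF z w])
  moreover have "Q w z u = u' + (w - z) *\<^sub>C N w f"
  proof -
    have "u = Q w z u'" by (simp add: u'_def root_quot_inverse[OF z w])
    then show ?thesis by (simp add: root_quot_square[OF w] f)
  qed
  ultimately have "u' - A w u' = N w (h - w *\<^sub>C f)"
    by (simp add: Q_lin N_lin scaleC.diff_left algebra_simps)
  then show ?thesis using f by (auto simp: graph_at_def)
qed

lemma graph_at_unique:
  assumes z: "z \<in> resolvent_set H0" and "graph_at z f h" "graph_at z f h'"
  shows "h = h'"
proof -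
  note lin = bounded_clinear_simps[OF inv_root_bounded_clinear[OF z]]
  have inj: "x = y" if "N z x = N z y" for x y
    using inv_root_eq_0_iff[OF z, of "x - y"] that by (simp add: lin)
  obtain u u' where u: "f = N z u" "u - A z u = N z (h - z *\<^sub>C f)"
      and u': "f = N z u'" "u' - A z u' = N z (h' - z *\<^sub>C f)"
    using assms(2,3) unfolding graph_at_def by blast
  have "N z u = N z u'" by (rule trans[OF u(1)[symmetric] u'(1)])
  then have "u = u'" by (rule inj)
  then have "N z (h - z *\<^sub>C f) = N z (h' - z *\<^sub>C f)"
    using u(2) u'(2) by argo
  then show ?thesis using inj by force
qed

text \<open>The form sum of \<open>H0\<close> and \<open>V\<close>.  The argument is a reference point of the resolvent set of \<open>H0\<close>, on which
  the operator does not depend.\<close>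

definition perturbed :: "complex \<Rightarrow> 'a oper" where
  "perturbed z f = (if \<exists>h. graph_at z f h then Some (THE h. graph_at z f h) else None)"

lemma perturbed_eq_Some:
  assumes "z \<in> resolvent_set H0"
  shows "perturbed z f = Some h \<longleftrightarrow> graph_at z f h"
proof -
  have "(THE h. graph_at z f h) = h" if "graph_at z f h" for h
    using that graph_at_unique[OF assms] by (intro the_equality) blast+
  then show ?thesis unfolding perturbed_def by (metis option.discI option.inject)
qed

lemma not_in_D_set:
  assumes "z \<in> resolvent_set H0" "z \<notin> D_set E H0 V" "bounded_clinear (A z)"
  shows "bij (\<lambda>g. g - A z g)" "bounded_clinear (inv (\<lambda>g. g - A z g))"
  using assms one_in_resolvent_set_iff[OF assms(3)] by (auto simp: D_set_def)

lemma R_op_eq: "z \<in> resolvent_set H0 \<Longrightarrow> R_op E H0 V z = (\<lambda>f. N z (inv (\<lambda>g. g - A z g) (N z f)))"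
  by (simp add: fun_eq_iff R_op_def app_neg_half_power)

text \<open>The graph of the operator may be read off at \<open>z\<close> instead of the reference point \<open>w\<close>, and there the
  equation with \<open>h = k + z f\<close> is \<open>(I - A z) u = N z k\<close>.\<close>

lemma perturbed_is_resolvent_at:
  assumes w: "w \<in> resolvent_set H0" and z: "z \<in> resolvent_set H0" "z \<notin> D_set E H0 V"
    and A: "bounded_clinear (A z)"
  shows "is_resolvent_at (perturbed w) z (R_op E H0 V z)" and "bounded_clinear (R_op E H0 V z)"
proof -
  note bij = not_in_D_set(1)[OF z A] and bc = not_in_D_set(2)[OF z A]
  have "perturbed w f = Some (k + z *\<^sub>C f) \<longleftrightarrow> f = R_op E H0 V z k" for f k
  proof -
    have "perturbed w f = Some (k + z *\<^sub>C f) \<longleftrightarrow> graph_at z f (k + z *\<^sub>C f)"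
      using graph_at_change_point[OF w z(1)] graph_at_change_point[OF z(1) w] perturbed_eq_Some[OF w]
      by blast
    also have "\<dots> \<longleftrightarrow> (\<exists>u. f = N z u \<and> u - A z u = N z k)"
      by (simp add: graph_at_def)
    also have "\<dots> \<longleftrightarrow> (\<exists>u. f = N z u \<and> u = inv (\<lambda>g. g - A z g) (N z k))"
      using bij_inv_eq_iff[OF bij] by metis
    also have "\<dots> \<longleftrightarrow> f = R_op E H0 V z k" by (simp add: R_op_eq[OF z(1)])
    finally show ?thesis .
  qed
  then show "is_resolvent_at (perturbed w) z (R_op E H0 V z)" by (simp add: is_resolvent_at_iff)
  show "bounded_clinear (R_op E H0 V z)"
    unfolding R_op_eq[OF z(1)]
    by (intro bounded_clinear_compose[OF inv_root_bounded_clinear[OF z(1)]]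
        bounded_clinear_compose[OF bc] inv_root_bounded_clinear[OF z(1)])
qed

text \<open>A continuous map with dense range carries dense sets to dense sets, so the density of the range of \<open>N z\<close>
  passes to \<open>N z (I - A z)\<^sup>-\<^sup>1 N z\<close>.\<close>

lemma closure_range_R_op:
  assumes z: "z \<in> resolvent_set H0" "z \<notin> D_set E H0 V" and A: "bounded_clinear (A z)"
  shows "closure (range (R_op E H0 V z)) = UNIV"
proof -
  define S where "S = inv (\<lambda>g. g - A z g)"
  have dense: "closure (range (\<lambda>x. G (F x))) = UNIV"
    if F: "closure (range F) = UNIV" and G: "bounded_clinear G" "closure (range G) = UNIV"
    for F :: "'a \<Rightarrow> 'a" and G :: "'a \<Rightarrow> 'a"
  proof -
    have "G ` closure (range F) \<subseteq> closure (range (\<lambda>x. G (F x)))"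
      using closure_subset[of "range (\<lambda>x. G (F x))"] unfolding F
      by (intro image_closure_subset[where S = "range F", unfolded F]
          linear_continuous_on[OF bounded_clinear_bounded_linear[OF G(1)]]) auto
    then have "closure (range G) \<subseteq> closure (range (\<lambda>x. G (F x)))"
      unfolding F by (simp add: closure_minimal)
    then show ?thesis using G(2) by blast
  qed
  have "surj S"
    unfolding S_def using not_in_D_set(1)[OF z A] by (simp add: bij_imp_bij_inv bij_is_surj)
  then have "closure (range S) = UNIV" by simp
  moreover have "bounded_clinear S" unfolding S_def by (rule not_in_D_set(2)[OF z A])
  moreover note N = closure_range_inv_root[OF z(1)]
  ultimately have "closure (range (\<lambda>f. S (N z f))) = UNIV" by (intro dense[OF N])
  from dense[OF this inv_root_bounded_clinear[OF z(1)] N]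
  have "closure (range (\<lambda>f. N z (S (N z f)))) = UNIV" .
  then show ?thesis by (simp add: R_op_eq[OF z(1)] S_def)
qed

text \<open>With \<open>S = (I - A)\<^sup>-\<^sup>1\<close> one has \<open>S - I = A S\<close>, so \<open>R(z) - (H0 - z)\<^sup>-\<^sup>1 = N A S N\<close>.\<close>

lemma compact_R_op_minus_resolvent:
  assumes z: "z \<in> resolvent_set H0" "z \<notin> D_set E H0 V" and A: "compact_op (A z)"
  shows "compact_op (\<lambda>f. R_op E H0 V z f - resolvent H0 z f)"
proof -
  have bA: "bounded_clinear (A z)" using A by (simp add: compact_op_def)
  note bij = not_in_D_set(1)[OF z bA] and bc = not_in_D_set(2)[OF z bA]
  define S where "S = inv (\<lambda>g. g - A z g)"
  have S: "S k - k = A z (S k)" for k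
    using surj_f_inv_f[OF bij_is_surj[OF bij], of k] unfolding S_def by (simp add: algebra_simps)
  have "R_op E H0 V z f - resolvent H0 z f = N z (A z (S (N z f)))" for f
    by (simp add: R_op_eq[OF z(1)] resolvent_eq_inv_root_square[OF z(1)]
        bounded_clinear_simps[OF inv_root_bounded_clinear[OF z(1)]] flip: S_def S)
  then show ?thesis
    using compact_op_compose[OF A inv_root_bounded_clinear[OF z(1)]
        bounded_clinear_compose[OF bc inv_root_bounded_clinear[OF z(1)]]]
    by (simp add: S_def)
qed

end

theorem theorem2p8:
  fixes H0 :: "'a::chilbert_space oper"
    and E :: "real set \<Rightarrow> 'a \<Rightarrow> 'a"
    and V :: "'a \<Rightarrow> 'a \<Rightarrow> complex"
    and E\<^sub>0 :: real
  assumes separable: "separable_space (euclidean :: 'a topology)"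
    and selfadjoint: "selfadjoint_op H0"
    and nonneg: "nonneg_op H0"
    and spectral_family: "is_spectral_family E H0"
    and V_bounded: "bounded_linear_plus_minus E H0 V"
    and A_compact: "\<exists>z\<in>resolvent_set H0. compact_op (A_op E H0 V z)"
    and E0_neg: "E\<^sub>0 < 0"
    and A_small: "onorm (A_op E H0 V (complex_of_real E\<^sub>0)) < 1"
  shows "(\<forall>z\<in>resolvent_set H0. compact_op (A_op E H0 V z)) \<and>
    (\<exists>H :: 'a oper.
       linear_op H \<and> densely_defined H \<and> closed_op H \<and>
       (\<forall>z \<in> resolvent_set H0 - D_set E H0 V. is_resolvent_at H z (R_op E H0 V z)) \<and>
       (\<forall>z \<in> resolvent_set H0 - D_set E H0 V. \<forall>H'.
          linear_op H' \<and> densely_defined H' \<and> closed_op H' \<and>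
          is_resolvent_at H' z (R_op E H0 V z) \<longrightarrow> H' = H) \<and>
       resolvent_set H0 - D_set E H0 V \<subseteq> resolvent_set H \<and>
       (\<forall>z \<in> resolvent_set H0 \<inter> resolvent_set H.
          compact_op (\<lambda>f. resolvent H z f - resolvent H0 z f)))"
proof -
  interpret form_perturbation E H0 V
    using spectral_family V_bounded by unfold_locales (auto simp: is_spectral_family_def)
  let ?w = "complex_of_real E\<^sub>0"
  have compact: "compact_op (A_op E H0 V z)" if "z \<in> resolvent_set H0" for z
    using A_compact compact_A_op that by blast
  then have bc: "bounded_clinear (A_op E H0 V z)" if "z \<in> resolvent_set H0" for z
    using that by (simp add: compact_op_def)
  have w: "?w \<in> resolvent_set H0" by (rule negative_in_resolvent_set[OF nonneg E0_neg])
  have w': "?w \<notin> D_set E H0 V"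
    using bij_ident_minus_contraction[OF bc[OF w] A_small]
    by (simp add: D_set_def one_in_resolvent_set_iff[OF bc[OF w]])
  define H where "H = perturbed ?w"
  have res: "is_resolvent_at H z (R_op E H0 V z)" and bcR: "bounded_clinear (R_op E H0 V z)"
    if "z \<in> resolvent_set H0 - D_set E H0 V" for z
    using perturbed_is_resolvent_at[OF w, of z] bc that by (auto simp: H_def)
  note H = is_resolvent_at_imp_linear_closed[OF res bcR, of ?w, OF DiffI DiffI, OF w w' w w']
  have sub: "resolvent_set H0 - D_set E H0 V \<subseteq> resolvent_set H"
    using res bcR by (auto intro: resolvent_setI)
  have "compact_op (\<lambda>f. resolvent H ?w f - resolvent H0 ?w f)"
    using compact_R_op_minus_resolvent[OF w w' compact[OF w]] is_resolvent_at_imp_resolvent[OF res] w w'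
    by simp
  then have "compact_op (\<lambda>f. resolvent H z f - resolvent H0 z f)"
    if "z \<in> resolvent_set H0 \<inter> resolvent_set H" for z
    using that w w' sub by (intro compact_resolvent_difference_transfer[of z H ?w H0]) auto
  moreover have "densely_defined H"
    using H(3) closure_range_R_op[OF w w' bc[OF w]] by (simp add: densely_defined_def)
  moreover have "H' = H" if "is_resolvent_at H' z (R_op E H0 V z)" "z \<in> resolvent_set H0 - D_set E H0 V" for z H'
    using is_resolvent_at_unique that res by blast
  ultimately show ?thesis
    using compact H(1,2) res sub by blast
qed

end
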